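(* The set of finite TRSs $R$ that are weakly ground confluent, i.e. weakly confluent on every ground term, is $\Pi^0_2$-complete.
   Context: All TRSs are finite sets of rules over a finite signature; terms may contain variables, ground terms contain none. A TRS $R$ is weakly confluent on a term $t$ if for all terms $t_1,t_2$ with $t_1\leftarrow_R t\to_R t_2$ (single steps) there is a term $d$ with $t_1\to_R^* d\leftarrow_R^* t_2$. TRSs and terms are encoded as natural numbers by a standard effective Gödel numbering, and properties are identified with the corresponding sets of codes. $\Sigma^0_n,\Pi^0_n$ are the classes of the arithmetical hierarchy; a set $B$ is $\mathcal P$-complete if $B\in\mathcal P$ and every $A\in\mathcal P$ is many-one reducible to $B$ via a total computable function. *)

theory Defs
  imports Main "HOL-Library.Nat_Bijection"
begin

datatype recf = Zero | Succ | Proj nat | Comp recf "recf list" | Prec recf recf | Mu recf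

lemma list_all2_mono_ind [mono]:
  "(\<And>x y. P x y \<longrightarrow> Q x y) \<Longrightarrow> list_all2 P xs ys \<longrightarrow> list_all2 Q xs ys"
  by (auto elim: list_all2_mono)

inductive eval :: "recf \<Rightarrow> nat list \<Rightarrow> nat \<Rightarrow> bool" where
  ev_zero: "eval Zero xs 0"
| ev_succ: "eval Succ (x # xs) (Suc x)"
| ev_proj: "i < length xs \<Longrightarrow> eval (Proj i) xs (xs ! i)"
| ev_comp: "list_all2 (\<lambda>g y. eval g xs y) gs ys \<Longrightarrow> eval f ys z \<Longrightarrow> eval (Comp f gs) xs z"
| ev_prec0: "eval f xs y \<Longrightarrow> eval (Prec f g) (0 # xs) y"
| ev_precS: "eval (Prec f g) (n # xs) y \<Longrightarrow> eval g (y # n # xs) z \<Longrightarrow> eval (Prec f g) (Suc n # xs) z"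
| ev_mu: "eval f (n # xs) 0 \<Longrightarrow> (\<forall>m<n. \<exists>y. eval f (m # xs) (Suc y)) \<Longrightarrow> eval (Mu f) xs n"

definition total_computable :: "(nat \<Rightarrow> nat) \<Rightarrow> bool" where
  "total_computable f \<longleftrightarrow> (\<exists>p. \<forall>n. eval p [n] (f n))"

definition decidable3 :: "(nat \<Rightarrow> nat \<Rightarrow> nat \<Rightarrow> bool) \<Rightarrow> bool" where
  "decidable3 R \<longleftrightarrow> (\<exists>p. \<forall>n x y. eval p [n, x, y] (if R n x y then 1 else 0))"

definition Pi02 :: "nat set set" where
  "Pi02 = {A. \<exists>R. decidable3 R \<and> A = {n. \<forall>x. \<exists>y. R n x y}}"

definition many_one_reducible :: "nat set \<Rightarrow> nat set \<Rightarrow> bool" where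
  "many_one_reducible A B \<longleftrightarrow> (\<exists>f. total_computable f \<and> (\<forall>n. n \<in> A \<longleftrightarrow> f n \<in> B))"

definition Pi02_complete :: "nat set \<Rightarrow> bool" where
  "Pi02_complete B \<longleftrightarrow> B \<in> Pi02 \<and> (\<forall>A \<in> Pi02. many_one_reducible A B)"

datatype trm = Var nat | Fun nat "trm list"

fun vars :: "trm \<Rightarrow> nat set" where
  "vars (Var x) = {x}"
| "vars (Fun f ts) = (\<Union>t \<in> set ts. vars t)"

definition ground :: "trm \<Rightarrow> bool" where
  "ground t \<longleftrightarrow> vars t = {}"

text \<open>A signature is a finite list of (function symbol, arity) pairs.\<close>
type_synonym signature = "(nat \<times> nat) list"

fun wf_term :: "signature \<Rightarrow> trm \<Rightarrow> bool" where
  "wf_term F (Var x) = True"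
| "wf_term F (Fun f ts) = ((f, length ts) \<in> set F \<and> (\<forall>t \<in> set ts. wf_term F t))"

fun subst :: "(nat \<Rightarrow> trm) \<Rightarrow> trm \<Rightarrow> trm" where
  "subst \<sigma> (Var x) = \<sigma> x"
| "subst \<sigma> (Fun f ts) = Fun f (map (subst \<sigma>) ts)"

type_synonym trs = "signature \<times> (trm \<times> trm) list"

definition wf_trs :: "trs \<Rightarrow> bool" where
  "wf_trs R \<longleftrightarrow> distinct (map fst (fst R)) \<and>
     (\<forall>(l, r) \<in> set (snd R). wf_term (fst R) l \<and> wf_term (fst R) r \<and>
         (\<forall>x. l \<noteq> Var x) \<and> vars r \<subseteq> vars l)"

inductive rstep :: "trs \<Rightarrow> trm \<Rightarrow> trm \<Rightarrow> bool" for R where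
  root: "(l, r) \<in> set (snd R) \<Longrightarrow> rstep R (subst \<sigma> l) (subst \<sigma> r)"
| ctxt: "rstep R s t \<Longrightarrow> i < length ts \<Longrightarrow> ts ! i = s \<Longrightarrow> rstep R (Fun f ts) (Fun f (ts[i := t]))"

definition weakly_confluent_on :: "trs \<Rightarrow> trm \<Rightarrow> bool" where
  "weakly_confluent_on R t \<longleftrightarrow>
     (\<forall>t1 t2. rstep R t t1 \<and> rstep R t t2 \<longrightarrow> (\<exists>d. (rstep R)\<^sup>*\<^sup>* t1 d \<and> (rstep R)\<^sup>*\<^sup>* t2 d))"

definition weakly_ground_confluent :: "trs \<Rightarrow> bool" where
  "weakly_ground_confluent R \<longleftrightarrow>
     (\<forall>t. ground t \<and> wf_term (fst R) t \<longrightarrow> weakly_confluent_on R t)"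

fun encode_term :: "trm \<Rightarrow> nat" where
  "encode_term (Var x) = prod_encode (0, x)"
| "encode_term (Fun f ts) = prod_encode (Suc f, list_encode (map encode_term ts))"

definition encode_trs :: "trs \<Rightarrow> nat" where
  "encode_trs R = prod_encode
     (list_encode (map prod_encode (fst R)),
      list_encode (map (\<lambda>(l, r). prod_encode (encode_term l, encode_term r)) (snd R)))"

definition WGCR_codes :: "nat set" where
  "WGCR_codes = {encode_trs R | R. wf_trs R \<and> weakly_ground_confluent R}"

end

theory Submission
  imports Defs
begin

text \<open>
  \<^emph>\<open>Membership.\<close> Term codes are binary trees, so well-formedness, substitution, rewriting and
  reachability are least models of a finite set of Horn clauses over patterns built from zero,
  successor and pairing. A least model of this kind is recursively enumerable: a certificate is the
  list of the facts of a derivation, each with the environment that instantiates its clause.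
  Weak ground confluence thus says that every certificate of a peak is matched by one of a join.

  \<^emph>\<open>Hardness.\<close> For \<open>A = {n. \<forall>x. \<exists>y. Q n x y}\<close> take a fixed orthogonal interpreter for recursive
  functions and let \<open>f\<close> be the program searching for \<open>y\<close>. The only critical peak is
  \<open>ok \<leftarrow> start(x) \<rightarrow> check(x, 0)\<close>, where \<open>check\<close> copies a numeral written with separate input
  constructors and then runs \<open>f\<close> on \<open>n\<close> and the copy, ending in \<open>ok\<close> if this halts. If \<open>check\<close> meets
  any other function symbol it ends in \<open>ok\<close> at once. No rule yields a term headed by an
  input constructor, so these rules do no harm even if the checked term is itself reducible. Hence the
  system is weakly ground confluent if \<open>f\<close> halts on \<open>(n, x)\<close> for all \<open>x\<close>. For the converse,
  a value is attached to those interpreter terms all of whose subcomputations halt; steps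
  preserve it, so a diverging search can never reach \<open>ok\<close>.
\<close>

section \<open>Computable functions\<close>

definition computable2 :: "(nat \<Rightarrow> nat \<Rightarrow> nat) \<Rightarrow> bool" where
  "computable2 g \<longleftrightarrow> (\<exists>p. \<forall>x y. eval p [x, y] (g x y))"

lemma eval_Proj: "i < length xs \<Longrightarrow> xs ! i = y \<Longrightarrow> eval (Proj i) xs y"
  using ev_proj by blast

lemma eval_Comp1: "eval g xs y \<Longrightarrow> eval f [y] z \<Longrightarrow> eval (Comp f [g]) xs z"
  by (rule ev_comp[where ys = "[y]"]) auto

lemma eval_Comp2:
  "eval g xs y \<Longrightarrow> eval h xs w \<Longrightarrow> eval f [y, w] z \<Longrightarrow> eval (Comp f [g, h]) xs z"
  by (rule ev_comp[where ys = "[y, w]"]) auto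

lemma total_computable_id: "total_computable (\<lambda>n. n)"
  unfolding total_computable_def
  by (intro exI[of _ "Proj 0"] allI eval_Proj) auto

lemma total_computable_comp:
  assumes "total_computable f" "total_computable g"
  shows "total_computable (\<lambda>n. f (g n))"
proof -
  obtain p q where "\<And>n. eval p [n] (f n)" "\<And>n. eval q [n] (g n)"
    using assms unfolding total_computable_def by auto
  then show ?thesis
    unfolding total_computable_def
    by (intro exI[of _ "Comp p [q]"] allI eval_Comp1)
qed

lemma computable2_comp:
  assumes "computable2 g" "total_computable f" "total_computable h"
  shows "total_computable (\<lambda>n. g (f n) (h n))"
proof -
  obtain p q r where "\<And>x y. eval p [x, y] (g x y)" "\<And>n. eval q [n] (f n)" "\<And>n. eval r [n] (h n)"
    using assms unfolding total_computable_def computable2_def by metis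
  then show ?thesis
    unfolding total_computable_def
    by (intro exI[of _ "Comp p [q, r]"] allI eval_Comp2)
qed

lemma total_computable_Suc:
  assumes "total_computable f"
  shows "total_computable (\<lambda>n. Suc (f n))"
proof -
  have "total_computable Suc"
    unfolding total_computable_def by (intro exI[of _ Succ] allI ev_succ)
  from total_computable_comp[OF this assms] show ?thesis .
qed

lemma total_computable_const: "total_computable (\<lambda>n. c)"
proof (induction c)
  case 0
  show ?case unfolding total_computable_def by (intro exI[of _ Zero] allI ev_zero)
qed (rule total_computable_Suc)

lemma computable2_add: "computable2 (+)"
proof -
  let ?p = "Prec (Proj 0) (Comp Succ [Proj 0])"
  have "eval ?p [x, y] (x + y)" for x y
    by (induction x) (auto intro!: ev_prec0 ev_precS eval_Proj eval_Comp1 ev_succ)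
  then show ?thesis unfolding computable2_def by blast
qed

lemma total_computable_pred: "total_computable (\<lambda>n. n - 1)"
proof -
  have "eval (Prec Zero (Proj 1)) [n] (n - 1)" for n
    by (induction n) (auto intro!: ev_prec0 ev_zero ev_precS intro: eval_Proj)
  then show ?thesis unfolding total_computable_def by blast
qed

lemma computable2_flip:
  assumes "computable2 g"
  shows "computable2 (\<lambda>x y. g y x)"
proof -
  obtain p where "\<And>x y. eval p [x, y] (g x y)"
    using assms unfolding computable2_def by auto
  then have "eval (Comp p [Proj 1, Proj 0]) [x, y] (g y x)" for x y
    by (intro eval_Comp2[where y = y and w = x]) (auto intro: eval_Proj)
  then show ?thesis unfolding computable2_def by blast
qed

text \<open>\<open>Prec\<close> recurses on its first argument, so subtraction is built with the
  subtrahend first, as iterated predecessor, and then flipped.\<close>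

lemma computable2_diff: "computable2 (-)"
proof -
  obtain p where p: "\<And>n. eval p [n] (n - 1)"
    using total_computable_pred unfolding total_computable_def by blast
  have "eval (Prec (Proj 0) (Comp p [Proj 0])) [x, y] (y - x)" for x y
  proof (induction x)
    case 0
    then show ?case by (auto intro!: ev_prec0 eval_Proj)
  next
    case (Suc x)
    then show ?case using p[of "y - x"]
      by (auto intro!: eval_Proj eval_Comp1 elim!: ev_precS)
  qed
  then have "computable2 (\<lambda>x y. y - x)" unfolding computable2_def by blast
  from computable2_flip[OF this] show ?thesis .
qed

section \<open>The Cantor pairing and its inverse\<close>

lemma total_computable_triangle: "total_computable triangle"
proof -
  obtain p where p: "\<And>x y. eval p [x, y] (x + y)"
    using computable2_add unfolding computable2_def by blast
  have "eval (Prec Zero (Comp p [Proj 0, Comp Succ [Proj 1]])) [n] (triangle n)" for n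
  proof (induction n)
    case 0
    then show ?case by (auto intro!: ev_prec0 ev_zero)
  next
    case (Suc n)
    have "eval (Comp p [Proj 0, Comp Succ [Proj 1]]) [triangle n, n] (triangle (Suc n))"
      unfolding triangle_Suc
      by (rule eval_Comp2[OF eval_Proj eval_Comp1[OF eval_Proj ev_succ] p]) auto
    with Suc show ?case by (rule ev_precS)
  qed
  then show ?thesis unfolding total_computable_def by blast
qed

abbreviation pair_code :: "nat \<Rightarrow> nat \<Rightarrow> nat" where
  "pair_code x y \<equiv> prod_encode (x, y)"

abbreviation pfst :: "nat \<Rightarrow> nat" where
  "pfst n \<equiv> fst (prod_decode n)"

abbreviation psnd :: "nat \<Rightarrow> nat" where
  "psnd n \<equiv> snd (prod_decode n)"

lemmas total_computable_diff = computable2_comp[OF computable2_diff]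

lemma computable2_pair: "computable2 pair_code"
proof -
  obtain p where p: "\<And>x y. eval p [x, y] (x + y)"
    using computable2_add unfolding computable2_def by blast
  obtain q where q: "\<And>n. eval q [n] (triangle n)"
    using total_computable_triangle unfolding total_computable_def by blast
  have "eval (Comp p [Comp q [p], Proj 0]) [x, y] (pair_code x y)" for x y
    unfolding prod_encode_def prod.case
    by (rule eval_Comp2[OF eval_Comp1[OF p q] eval_Proj p]) auto
  then show ?thesis unfolding computable2_def by blast
qed

lemmas total_computable_pair = computable2_comp[OF computable2_pair]

text \<open>The greatest \<open>k\<close> with \<open>triangle k \<le> n\<close>. Counting upwards
  makes this inverse of \<open>triangle\<close> primitive recursive: the summand
  \<open>1 - (...)\<close> is 1 when \<open>Suc n\<close> reaches the next triangular number, and 0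
  otherwise.\<close>

fun triroot :: "nat \<Rightarrow> nat" where
  "triroot 0 = 0"
| "triroot (Suc n) = triroot n + (1 - (triangle (Suc (triroot n)) - Suc n))"

lemma triroot_bounds: "triangle (triroot n) \<le> n \<and> n < triangle (Suc (triroot n))"
proof (induction n)
  case (Suc n)
  then show ?case
    by (cases "triangle (Suc (triroot n)) = Suc n") auto
qed simp

text \<open>The number \<open>n\<close> lies on diagonal \<open>triroot n\<close> of the pairing,
  and its offset there is the first component. Both components thus become differences of computable
  functions.\<close>

lemma prod_decode_triroot:
  "prod_decode n = (n - triangle (triroot n), triroot n - (n - triangle (triroot n)))"
proof -
  let ?k = "triroot n"
  have "n = triangle ?k + (n - triangle ?k)" using triroot_bounds[of n] by simp
  then have "prod_decode n = prod_decode_aux ?k (n - triangle ?k)"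
    by (metis prod_decode_triangle_add)
  also have "\<dots> = (n - triangle ?k, ?k - (n - triangle ?k))"
    using triroot_bounds[of n] by (subst prod_decode_aux.simps) auto
  finally show ?thesis .
qed

lemma total_computable_triroot: "total_computable triroot"
proof -
  define s where "s x n = x + (1 - (triangle (Suc x) - Suc n))" for x n
  obtain p where p: "\<And>x y. eval p [x, y] (x + y)"
    using computable2_add unfolding computable2_def by blast
  obtain d where d: "\<And>x y. eval d [x, y] (x - y)"
    using computable2_diff unfolding computable2_def by blast
  obtain q where q: "\<And>n. eval q [n] (triangle n)"
    using total_computable_triangle unfolding total_computable_def by blast
  let ?s = "Comp p [Proj 0, Comp d [Comp Succ [Zero],
    Comp d [Comp q [Comp Succ [Proj 0]], Comp Succ [Proj 1]]]]"
  have s: "eval ?s [x, n] (s x n)" for x n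
    unfolding s_def One_nat_def
    by (rule eval_Comp2[OF eval_Proj eval_Comp2[OF eval_Comp1[OF ev_zero ev_succ]
       eval_Comp2[OF eval_Comp1[OF eval_Comp1[OF eval_Proj ev_succ] q]
          eval_Comp1[OF eval_Proj ev_succ] d] d] p]) auto
  have "eval (Prec Zero ?s) [n] (triroot n)" for n
  proof (induction n)
    case 0
    then show ?case by (auto intro!: ev_prec0 ev_zero)
  next
    case (Suc n)
    then show ?case using s[of "triroot n" n] unfolding s_def triroot.simps by (rule ev_precS)
  qed
  then show ?thesis unfolding total_computable_def by blast
qed

lemma total_computable_pfst:
  assumes "total_computable f"
  shows "total_computable (\<lambda>n. pfst (f n))"
proof (rule total_computable_comp[OF _ assms])
  show "total_computable pfst"
    unfolding prod_decode_triroot fst_conv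
    by (intro total_computable_diff total_computable_id total_computable_triroot
        total_computable_comp[OF total_computable_triangle])
qed

lemma total_computable_psnd:
  assumes "total_computable f"
  shows "total_computable (\<lambda>n. psnd (f n))"
proof (rule total_computable_comp[OF _ assms])
  show "total_computable psnd"
    unfolding prod_decode_triroot snd_conv
    by (intro total_computable_diff total_computable_id total_computable_triroot
        total_computable_comp[OF total_computable_triangle])
qed

text \<open>Closure rules are stated for unary functions, so the step function is presented as a
  function of the nested pair of parameter, counter and accumulator. \<open>Prec\<close> supplies
  these three in the reverse order.\<close>

lemma total_computable_rec:
  assumes "total_computable b" "total_computable m"
    and "total_computable (\<lambda>p. s (pfst p) (pfst (psnd p)) (psnd (psnd p)))"
  shows "total_computable (\<lambda>e. rec_nat (b e) (\<lambda>i a. s e i a) (m e))"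
proof -
  obtain B M S P where BMS: "\<And>n. eval B [n] (b n)" "\<And>n. eval M [n] (m n)"
      "\<And>n. eval S [n] (s (pfst n) (pfst (psnd n)) (psnd (psnd n)))"
    and P: "\<And>x y. eval P [x, y] (pair_code x y)"
    using assms computable2_pair unfolding total_computable_def computable2_def by metis
  let ?S = "Comp S [Comp P [Proj 2, Comp P [Proj 1, Proj 0]]]"
  have S: "eval ?S [a, i, e] (s e i a)" for a i e
    using BMS(3)[of "pair_code e (pair_code i a)"]
    by (intro eval_Comp1[OF eval_Comp2[OF eval_Proj eval_Comp2[OF eval_Proj eval_Proj P] P]])
      (auto intro: eval_Proj)
  have "eval (Prec B ?S) [k, e] (rec_nat (b e) (\<lambda>i a. s e i a) k)" for k e
  proof (induction k)
    case 0
    show ?case using BMS(1) by (auto intro: ev_prec0)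
  next
    case (Suc k)
    from ev_precS[OF this S] show ?case by simp
  qed
  then have "eval (Comp (Prec B ?S) [M, Proj 0]) [e] (rec_nat (b e) (\<lambda>i a. s e i a) (m e))" for e
    by (intro eval_Comp2[OF BMS(2) eval_Proj]) auto
  then show ?thesis unfolding total_computable_def by blast
qed

section \<open>Decidable predicates\<close>

definition decidable :: "(nat \<Rightarrow> bool) \<Rightarrow> bool" where
  "decidable P \<longleftrightarrow> total_computable (\<lambda>n. of_bool (P n))"

lemma decidable_not:
  assumes "decidable P"
  shows "decidable (\<lambda>n. \<not> P n)"
proof -
  have "total_computable (\<lambda>n. 1 - of_bool (P n))"
    using assms unfolding decidable_def
    by (intro total_computable_diff total_computable_const)
  then show ?thesis unfolding decidable_def
    by (elim back_subst[of total_computable]) auto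
qed

lemma decidable_conj:
  assumes "decidable P" "decidable Q"
  shows "decidable (\<lambda>n. P n \<and> Q n)"
proof -
  have "total_computable (\<lambda>n. of_bool (P n) - (1 - of_bool (Q n)))"
    using assms unfolding decidable_def
    by (intro total_computable_diff total_computable_const)
  then show ?thesis unfolding decidable_def
    by (elim back_subst[of total_computable]) auto
qed

lemma decidable_disj: "decidable P \<Longrightarrow> decidable Q \<Longrightarrow> decidable (\<lambda>n. P n \<or> Q n)"
  using decidable_not[OF decidable_conj[OF decidable_not decidable_not]] by simp

lemma decidable_imp: "decidable P \<Longrightarrow> decidable Q \<Longrightarrow> decidable (\<lambda>n. P n \<longrightarrow> Q n)"
  unfolding imp_conv_disj by (rule decidable_disj[OF decidable_not])

lemma decidable_const: "decidable (\<lambda>n. P)"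
  unfolding decidable_def by (rule total_computable_const)

lemma decidable_less:
  assumes "total_computable f" "total_computable g"
  shows "decidable (\<lambda>n. f n < g n)"
proof -
  have "total_computable (\<lambda>n. 1 - (1 - (g n - f n)))"
    using assms by (intro total_computable_diff total_computable_const)
  then show ?thesis unfolding decidable_def
    by (elim back_subst[of total_computable]) auto
qed

lemma decidable_eq: "total_computable f \<Longrightarrow> total_computable g \<Longrightarrow> decidable (\<lambda>n. f n = g n)"
  using decidable_not[OF decidable_disj[OF decidable_less decidable_less], of f g g f]
  by (simp add: nat_neq_iff[symmetric])

text \<open>A recursion over \<open>i\<close> carries the truth value of the disjunction so far in
  its accumulator \<open>a\<close>; the step is a disjunction written with negation and
  conjunction.\<close>

lemma decidable_bounded_ex:
  assumes "total_computable m" "decidable (\<lambda>p. P (pfst p) (psnd p))"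
  shows "decidable (\<lambda>e. \<exists>i < m e. P e i)"
proof -
  have *: "rec_nat 0 (\<lambda>i a. of_bool (\<not> (a = 0 \<and> \<not> P e i))) k = of_bool (\<exists>i<k. P e i)" for e k
    by (induction k) (auto simp: less_Suc_eq)
  have "decidable (\<lambda>p. P (pfst p) (pfst (psnd p)))"
    using total_computable_comp[OF assms(2)[unfolded decidable_def],
       of "\<lambda>p. pair_code (pfst p) (pfst (psnd p))"]
    by (simp add: decidable_def total_computable_pair total_computable_pfst
        total_computable_psnd total_computable_id)
  then have "total_computable (\<lambda>e. rec_nat 0 (\<lambda>i a. of_bool (\<not> (a = 0 \<and> \<not> P e i))) (m e))"
    by (intro total_computable_rec total_computable_const assms(1))
      (fold decidable_def, intro decidable_not decidable_conj decidable_eq total_computable_const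
        total_computable_psnd total_computable_id)
  then show ?thesis unfolding * decidable_def .
qed

lemma decidable_bounded_all:
  assumes "total_computable m" "decidable (\<lambda>p. P (pfst p) (psnd p))"
  shows "decidable (\<lambda>e. \<forall>i < m e. P e i)"
  using decidable_not[OF decidable_bounded_ex[OF assms(1) decidable_not[OF assms(2)]]] by simp

text \<open>The list is fixed and no part of the input, so the quantifier is a finite disjunction.
  It serves for the choice of a clause.\<close>

lemma decidable_list_ex:
  assumes "\<And>c. c \<in> set cs \<Longrightarrow> decidable (P c)"
  shows "decidable (\<lambda>e. \<exists>c \<in> set cs. P c e)"
  using assms
proof (induction cs)
  case Nil
  show ?case by (simp add: decidable_const)
next
  case (Cons c cs)
  then have "decidable (P c)" "decidable (\<lambda>e. \<exists>c \<in> set cs. P c e)" by simp_all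
  from decidable_disj[OF this] show ?case by simp
qed

lemma decidable_list_all:
  assumes "\<And>c. c \<in> set cs \<Longrightarrow> decidable (P c)"
  shows "decidable (\<lambda>e. \<forall>c \<in> set cs. P c e)"
  using assms
proof (induction cs)
  case Nil
  show ?case by (simp add: decidable_const)
next
  case (Cons c cs)
  then have "decidable (P c)" "decidable (\<lambda>e. \<forall>c \<in> set cs. P c e)" by simp_all
  from decidable_conj[OF this] show ?case by simp
qed

lemma decidable3I:
  assumes "decidable (\<lambda>e. R (pfst e) (pfst (psnd e)) (psnd (psnd e)))"
  shows "decidable3 R"
proof -
  obtain p q where p: "\<And>e. eval p [e] (of_bool (R (pfst e) (pfst (psnd e)) (psnd (psnd e))))"
    and q: "\<And>x y. eval q [x, y] (pair_code x y)"
    using assms computable2_pair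
    unfolding decidable_def total_computable_def computable2_def by metis
  have "eval (Comp p [Comp q [Proj 0, Comp q [Proj 1, Proj 2]]]) [n, x, y] (of_bool (R n x y))"
    for n x y
    using p[of "pair_code n (pair_code x y)"]
    by (intro eval_Comp1[OF eval_Comp2[OF eval_Proj eval_Comp2[OF eval_Proj eval_Proj q] q]])
      (auto intro: eval_Proj)
  then show ?thesis unfolding decidable3_def of_bool_def by blast
qed

section \<open>Horn clauses over the natural numbers\<close>

text \<open>The code of a nonempty list is the successor of a pair of head and tail code:
  \<open>a - 1\<close> strips the successor and \<open>psnd\<close> passes to the tail. Beyond the
  end of the list the value is arbitrary but defined, so the function is total.\<close>

definition nth_code :: "nat \<Rightarrow> nat \<Rightarrow> nat" where
  "nth_code l i = pfst (rec_nat l (\<lambda>_ a. psnd (a - 1)) i - 1)"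

lemma nth_code_Suc: "nth_code l (Suc i) = nth_code (psnd (l - 1)) i"
proof -
  have "rec_nat l (\<lambda>_ a. psnd (a - 1)) (Suc i) = rec_nat (psnd (l - 1)) (\<lambda>_ a. psnd (a - 1)) i"
    by (induction i) simp_all
  then show ?thesis unfolding nth_code_def by simp
qed

lemma nth_code_Cons [simp]:
  "nth_code (list_encode (x # xs)) 0 = x"
  "nth_code (list_encode (x # xs)) (Suc i) = nth_code (list_encode xs) i"
  by (simp_all add: nth_code_Suc, simp add: nth_code_def)

lemma nth_code_list_encode: "i < length xs \<Longrightarrow> nth_code (list_encode xs) i = xs ! i"
proof (induction xs arbitrary: i)
  case (Cons x xs)
  then show ?case by (cases i) (simp_all del: list_encode.simps)
qed simp

lemma total_computable_nth_code:
  assumes "total_computable f" "total_computable g"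
  shows "total_computable (\<lambda>n. nth_code (f n) (g n))"
  unfolding nth_code_def
  by (intro total_computable_pfst total_computable_psnd total_computable_diff
      total_computable_const total_computable_rec total_computable_id assms)

text \<open>These are the operations from which list and term codes are built. All are computable,
  so a fixed pattern is instantiated computably in the environment.\<close>

datatype pat = PVar nat | PConst nat | PSuc pat | PPair pat pat

primrec inst :: "nat \<Rightarrow> pat \<Rightarrow> nat" where
  "inst \<rho> (PVar i) = nth_code \<rho> i"
| "inst \<rho> (PConst c) = c"
| "inst \<rho> (PSuc p) = Suc (inst \<rho> p)"
| "inst \<rho> (PPair p q) = pair_code (inst \<rho> p) (inst \<rho> q)"

lemma total_computable_inst:
  assumes "total_computable f"
  shows "total_computable (\<lambda>n. inst (f n) p)"
  by (induction p) (simp_all add: assms total_computable_nth_code total_computable_const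
      total_computable_Suc total_computable_pair)

type_synonym clause = "pat \<times> pat list"

text \<open>Environments are list codes rather than functions so that certificates can contain them.\<close>

inductive horn :: "clause list \<Rightarrow> nat \<Rightarrow> bool" for Cs where
  horn: "(c, ps) \<in> set Cs \<Longrightarrow> (\<forall>p \<in> set ps. horn Cs (inst \<rho> p)) \<Longrightarrow> horn Cs (inst \<rho> c)"

section \<open>Certificates for derivability\<close>

definition justified :: "clause list \<Rightarrow> nat \<Rightarrow> nat set \<Rightarrow> bool" where
  "justified Cs e X \<longleftrightarrow> (\<exists>C \<in> set Cs. pfst e = inst (psnd e) (fst C) \<and>
     (\<forall>p \<in> set (snd C). \<exists>e' \<in> X. pfst e' = inst (psnd e) p))"

text \<open>An entry may refer only to entries behind it. This rules out circular justification and
  lets derivations of several premises be appended.\<close>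

fun derivation :: "clause list \<Rightarrow> nat list \<Rightarrow> bool" where
  "derivation Cs [] \<longleftrightarrow> True"
| "derivation Cs (e # es) \<longleftrightarrow> justified Cs e (set es) \<and> derivation Cs es"

lemma justified_mono: "justified Cs e X \<Longrightarrow> X \<subseteq> Y \<Longrightarrow> justified Cs e Y"
  unfolding justified_def by blast

lemma derivation_append: "derivation Cs xs \<Longrightarrow> derivation Cs ys \<Longrightarrow> derivation Cs (xs @ ys)"
  by (induction xs) (auto elim: justified_mono)

lemma derivation_sound: "derivation Cs es \<Longrightarrow> e \<in> set es \<Longrightarrow> horn Cs (pfst e)"
proof (induction es arbitrary: e)
  case (Cons d es)
  then have es: "\<And>e. e \<in> set es \<Longrightarrow> horn Cs (pfst e)" and "justified Cs d (set es)" by auto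
  then obtain c ps where "(c, ps) \<in> set Cs" "pfst d = inst (psnd d) c"
    "\<forall>p \<in> set ps. \<exists>e' \<in> set es. pfst e' = inst (psnd d) p"
    unfolding justified_def by force
  then have "horn Cs (pfst d)" using es horn.horn[of c ps Cs "psnd d"] by metis
  then show ?case using Cons.prems es by auto
qed simp

lemma derivation_complete:
  assumes "horn Cs x"
  shows "\<exists>e es. derivation Cs (e # es) \<and> pfst e = x"
  using assms
proof induction
  case (horn c ps \<rho>)
  \<comment> \<open>Derivations of the single premises are merged into one list, by induction on the
    body of the clause.\<close>
  from horn(2) have "\<exists>es. derivation Cs es \<and> (\<forall>p \<in> set ps. \<exists>e' \<in> set es. pfst e' = inst \<rho> p)"
  proof (induction ps)
    case Nil
    show ?case by (rule exI[of _ "[]"]) simp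
  next
    case (Cons p ps)
    then obtain e ds es where "derivation Cs (e # ds)" "pfst e = inst \<rho> p"
      "derivation Cs es" "\<forall>p \<in> set ps. \<exists>e' \<in> set es. pfst e' = inst \<rho> p" by auto
    then show ?case
      by (intro exI[of _ "(e # ds) @ es"]) (auto simp: derivation_append simp del: append_Cons)
  qed
  then obtain es where "derivation Cs es" "\<forall>p \<in> set ps. \<exists>e' \<in> set es. pfst e' = inst \<rho> p" by blast
  with horn(1) show ?case
    by (intro exI[of _ "pair_code (inst \<rho> c) \<rho>"] exI[of _ es]) (force simp: justified_def)
qed

lemma derivation_iff_nth:
  "derivation Cs es \<longleftrightarrow>
    (\<forall>i < length es. justified Cs (es ! i) {es ! j | j. i < j \<and> j < length es})"
proof (induction es)
  case (Cons e es)
  have 1: "{(e # es) ! j | j. 0 < j \<and> j < Suc (length es)} = set es"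
    unfolding set_conv_nth by (auto simp: gr0_conv_Suc) force
  have 2: "{(e # es) ! j | j. Suc i < j \<and> j < Suc (length es)} = {es ! j | j. i < j \<and> j < length es}"
    for i
    by (force simp: Suc_less_eq2)
  show ?case
    by (simp only: derivation.simps Cons.IH length_Cons All_less_Suc2 nth_Cons_0 nth_Cons_Suc 1 2)
qed simp

text \<open>The condition on derivations, for the first \<open>N\<close> values of an access
  function \<open>s\<close> and with bounded quantifiers only. For \<open>s\<close> reading from a
  list code this is decidable; for \<open>s = (!) es\<close> it speaks of the list
  \<open>es\<close>.\<close>

definition certified :: "clause list \<Rightarrow> nat \<Rightarrow> (nat \<Rightarrow> nat) \<Rightarrow> nat \<Rightarrow> bool" where
  "certified Cs N s x \<longleftrightarrow> (\<exists>i < N. pfst (s i) = x) \<and>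
     (\<forall>i < N. \<exists>C \<in> set Cs. pfst (s i) = inst (psnd (s i)) (fst C) \<and>
        (\<forall>p \<in> set (snd C). \<exists>j < N. i < j \<and> pfst (s j) = inst (psnd (s i)) p))"

lemma certified_cong: 
  assumes "\<And>i. i < N \<Longrightarrow> s i = s' i"
  shows "certified Cs N s x \<longleftrightarrow> certified Cs N s' x"
  unfolding certified_def by (simp add: assms cong: conj_cong)

lemma certified_derivation:
  "certified Cs (length es) ((!) es) x \<longleftrightarrow> derivation Cs es \<and> (\<exists>e \<in> set es. pfst e = x)"
proof -
  have "(\<exists>i < length es. pfst (es ! i) = x) \<longleftrightarrow> (\<exists>e \<in> set es. pfst e = x)"
    by (metis in_set_conv_nth)
  moreover have "(\<exists>j < length es. i < j \<and> pfst (es ! j) = y) \<longleftrightarrow>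
      (\<exists>e' \<in> {es ! j | j. i < j \<and> j < length es}. pfst e' = y)" for i y
    by auto
  ultimately show ?thesis
    unfolding certified_def derivation_iff_nth justified_def by auto
qed

text \<open>A certificate carries the number of its entries explicitly, as the bound of the
  quantifiers.\<close>

definition certifies :: "clause list \<Rightarrow> nat \<Rightarrow> nat \<Rightarrow> bool" where
  "certifies Cs w x \<longleftrightarrow> certified Cs (pfst w) (nth_code (psnd w)) x"

theorem horn_iff_certifies: "horn Cs x \<longleftrightarrow> (\<exists>w. certifies Cs w x)"
proof
  assume "horn Cs x"
  then obtain e es where es: "derivation Cs (e # es)" "pfst e = x"
    using derivation_complete by blast
  have "certified Cs (length (e # es)) ((!) (e # es)) x"
    unfolding certified_derivation using es by simp
  then have "certified Cs (length (e # es)) (nth_code (list_encode (e # es))) x"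
    by (subst certified_cong[OF nth_code_list_encode])
  then have "certifies Cs (pair_code (length (e # es)) (list_encode (e # es))) x"
    unfolding certifies_def by (simp del: list_encode.simps)
  then show "\<exists>w. certifies Cs w x" by blast
next
  assume "\<exists>w. certifies Cs w x"
  then obtain w where w: "certifies Cs w x" by blast
  \<comment> \<open>Every \<open>w\<close> describes a list, namely the \<open>pfst w\<close> values
    that \<open>nth_code\<close> reads off, whether or not \<open>psnd w\<close> codes a list of
    that length.\<close>
  let ?es = "map (nth_code (psnd w)) [0..<pfst w]"
  have "certified Cs (pfst w) ((!) ?es) x"
    using w unfolding certifies_def by (subst certified_cong) auto
  then have "certified Cs (length ?es) ((!) ?es) x" by simp
  then show "horn Cs x"
    unfolding certified_derivation using derivation_sound by blast
qed

lemma decidable_certifies: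
  assumes "total_computable f" "total_computable g"
  shows "decidable (\<lambda>n. certifies Cs (f n) (g n))"
  unfolding certifies_def certified_def
  by (intro decidable_conj decidable_bounded_ex decidable_bounded_all decidable_list_ex
      decidable_list_all decidable_eq decidable_less total_computable_inst total_computable_nth_code
      total_computable_pfst total_computable_psnd total_computable_id
      total_computable_comp[OF assms(1)] total_computable_comp[OF assms(2)] assms)

section \<open>A Horn program for rewriting\<close>

text \<open>Computes the value of a pattern variable in an explicit environment, also at numeral
  positions.\<close>

lemma nth_code_Suc_pair [simp]:
  "nth_code (Suc (pair_code x l)) 0 = x"
  "nth_code (Suc (pair_code x l)) (Suc i) = nth_code l i"
  "nth_code (Suc (pair_code x l)) (numeral k) = nth_code l (pred_numeral k)"
  using nth_code_Cons[of x "list_decode l"] by (simp_all add: numeral_eq_Suc)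

abbreviation cons_code :: "nat \<Rightarrow> nat \<Rightarrow> nat" where
  "cons_code x l \<equiv> Suc (pair_code x l)"

abbreviation var_code :: "nat \<Rightarrow> nat" where
  "var_code x \<equiv> pair_code 0 x"

abbreviation fun_code :: "nat \<Rightarrow> nat \<Rightarrow> nat" where
  "fun_code f l \<equiv> pair_code (Suc f) l"

definition jdg :: "nat \<Rightarrow> nat list \<Rightarrow> nat" where
  "jdg k as = pair_code k (list_encode as)"

abbreviation PCons :: "pat \<Rightarrow> pat \<Rightarrow> pat" where
  "PCons p q \<equiv> PSuc (PPair p q)"

abbreviation PVarT :: "pat \<Rightarrow> pat" where
  "PVarT p \<equiv> PPair (PConst 0) p"

abbreviation PFunT :: "pat \<Rightarrow> pat \<Rightarrow> pat" where
  "PFunT p q \<equiv> PPair (PSuc p) q"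

definition pjdg :: "nat \<Rightarrow> pat list \<Rightarrow> pat" where
  "pjdg k ps = PPair (PConst k) (foldr PCons ps (PConst 0))"

lemma inst_pjdg [simp]: "inst \<rho> (pjdg k ps) = jdg k (map (inst \<rho>) ps)"
proof -
  have "inst \<rho> (foldr PCons ps (PConst 0)) = list_encode (map (inst \<rho>) ps)"
    by (induction ps) simp_all
  then show ?thesis by (simp add: pjdg_def jdg_def)
qed

abbreviation (input) j_neq :: nat where "j_neq \<equiv> 2"
abbreviation (input) j_mem :: nat where "j_mem \<equiv> 3"
abbreviation (input) j_fresh :: nat where "j_fresh \<equiv> 4"
abbreviation (input) j_dist :: nat where "j_dist \<equiv> 5"
abbreviation (input) j_wft :: nat where "j_wft \<equiv> 6"
abbreviation (input) j_wfl :: nat where "j_wfl \<equiv> 7"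
abbreviation (input) j_occ :: nat where "j_occ \<equiv> 8"
abbreviation (input) j_sub :: nat where "j_sub \<equiv> 9"
abbreviation (input) j_subl :: nat where "j_subl \<equiv> 10"
abbreviation (input) j_rules :: nat where "j_rules \<equiv> 11"
abbreviation (input) j_wf :: nat where "j_wf \<equiv> 12"
abbreviation (input) j_nth :: nat where "j_nth \<equiv> 13"
abbreviation (input) j_sb :: nat where "j_sb \<equiv> 14"
abbreviation (input) j_sbl :: nat where "j_sbl \<equiv> 15"
abbreviation (input) j_rs :: nat where "j_rs \<equiv> 16"
abbreviation (input) j_rsl :: nat where "j_rsl \<equiv> 17"
abbreviation (input) j_rt :: nat where "j_rt \<equiv> 18"
abbreviation (input) j_peak :: nat where "j_peak \<equiv> 19"
abbreviation (input) j_join :: nat where "j_join \<equiv> 20"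

text \<open>Clause variables get names by applying an abstraction to the pattern variables
  \<open>PVar 0\<close>, \<open>PVar 1\<close> and so on.\<close>

abbreviation (input) "clause1 C \<equiv> C (PVar 0)"
abbreviation (input) "clause2 C \<equiv> C (PVar 0) (PVar 1)"
abbreviation (input) "clause3 C \<equiv> C (PVar 0) (PVar 1) (PVar 2)"
abbreviation (input) "clause4 C \<equiv> C (PVar 0) (PVar 1) (PVar 2) (PVar 3)"
abbreviation (input) "clause5 C \<equiv> C (PVar 0) (PVar 1) (PVar 2) (PVar 3) (PVar 4)"
abbreviation (input) "clause6 C \<equiv> C (PVar 0) (PVar 1) (PVar 2) (PVar 3) (PVar 4) (PVar 5)"

text \<open>All clauses are positive, so distinctness of symbols is derived from
  \<open>j_neq\<close>, which compares numbers by peeling off successors. Substitutions are lists of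
  term codes. A term is ground if its variables are among those of the constant
  \<open>Fun 0 []\<close>. The source of a peak and the common reduct of a join occur only in clause
  bodies, that is, existentially.\<close>

definition trs_clauses :: "clause list" where
  "trs_clauses = [
    clause1 (\<lambda>b. (pjdg j_neq [PConst 0, PSuc b], [])),
    clause1 (\<lambda>a. (pjdg j_neq [PSuc a, PConst 0], [])),
    clause2 (\<lambda>a b. (pjdg j_neq [PSuc a, PSuc b], [pjdg j_neq [a, b]])),
    clause2 (\<lambda>a l. (pjdg j_mem [a, PCons a l], [])),
    clause3 (\<lambda>a b l. (pjdg j_mem [a, PCons b l], [pjdg j_mem [a, l]])),
    clause1 (\<lambda>f. (pjdg j_fresh [f, PConst 0], [])),
    clause4 (\<lambda>f g k l. (pjdg j_fresh [f, PCons (PPair g k) l], [pjdg j_neq [f, g], pjdg j_fresh [f, l]])),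
    (pjdg j_dist [PConst 0], []),
    clause3 (\<lambda>f k l. (pjdg j_dist [PCons (PPair f k) l], [pjdg j_fresh [f, l], pjdg j_dist [l]])),
    clause2 (\<lambda>F x. (pjdg j_wft [F, PVarT x], [])),
    clause4 (\<lambda>F f k l. (pjdg j_wft [F, PFunT f l], [pjdg j_mem [PPair f k, F], pjdg j_wfl [F, k, l]])),
    clause1 (\<lambda>F. (pjdg j_wfl [F, PConst 0, PConst 0], [])),
    clause4 (\<lambda>F k t l. (pjdg j_wfl [F, PSuc k, PCons t l], [pjdg j_wft [F, t], pjdg j_wfl [F, k, l]])),
    clause1 (\<lambda>x. (pjdg j_occ [x, PVarT x], [])),
    clause4 (\<lambda>x f t l. (pjdg j_occ [x, PFunT f l], [pjdg j_mem [t, l], pjdg j_occ [x, t]])),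
    clause2 (\<lambda>u x. (pjdg j_sub [u, PVarT x], [pjdg j_occ [x, u]])),
    clause3 (\<lambda>u f l. (pjdg j_sub [u, PFunT f l], [pjdg j_subl [u, l]])),
    clause1 (\<lambda>u. (pjdg j_subl [u, PConst 0], [])),
    clause3 (\<lambda>u t l. (pjdg j_subl [u, PCons t l], [pjdg j_sub [u, t], pjdg j_subl [u, l]])),
    clause1 (\<lambda>F. (pjdg j_rules [F, PConst 0], [])),
    clause5 (\<lambda>F f l r R. (pjdg j_rules [F, PCons (PPair (PFunT f l) r) R],
      [pjdg j_wft [F, PFunT f l],
       pjdg j_wft [F, r],
       pjdg j_sub [PFunT f l, r],
       pjdg j_rules [F, R]])),
    clause2 (\<lambda>F R. (pjdg j_wf [PPair F R], [pjdg j_dist [F], pjdg j_rules [F, R]])),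
    clause2 (\<lambda>s l. (pjdg j_nth [PCons s l, PConst 0, s], [])),
    clause4 (\<lambda>s t x l. (pjdg j_nth [PCons t l, PSuc x, s], [pjdg j_nth [l, x, s]])),
    clause3 (\<lambda>e x s. (pjdg j_sb [e, PVarT x, s], [pjdg j_nth [e, x, s]])),
    clause4 (\<lambda>e f l m. (pjdg j_sb [e, PFunT f l, PFunT f m], [pjdg j_sbl [e, l, m]])),
    clause1 (\<lambda>e. (pjdg j_sbl [e, PConst 0, PConst 0], [])),
    clause5 (\<lambda>e s t l m. (pjdg j_sbl [e, PCons s l, PCons t m], [pjdg j_sb [e, s, t], pjdg j_sbl [e, l, m]])),
    clause6 (\<lambda>R e l r s t. (pjdg j_rs [R, s, t],
      [pjdg j_mem [PPair l r, R],
       pjdg j_sb [e, l, s],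
       pjdg j_sb [e, r, t]])),
    clause4 (\<lambda>R f l m. (pjdg j_rs [R, PFunT f l, PFunT f m], [pjdg j_rsl [R, l, m]])),
    clause4 (\<lambda>R s t l. (pjdg j_rsl [R, PCons s l, PCons t l], [pjdg j_rs [R, s, t]])),
    clause4 (\<lambda>R s l m. (pjdg j_rsl [R, PCons s l, PCons s m], [pjdg j_rsl [R, l, m]])),
    clause2 (\<lambda>R s. (pjdg j_rt [R, s, s], [])),
    clause4 (\<lambda>R s t u. (pjdg j_rt [R, s, u], [pjdg j_rs [R, s, t], pjdg j_rt [R, t, u]])),
    clause5 (\<lambda>F R t u v. (pjdg j_peak [PPair F R, PPair u v],
      [pjdg j_wft [F, t],
       pjdg j_sub [PFunT (PConst 0) (PConst 0), t],
       pjdg j_rs [R, t, u],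
       pjdg j_rs [R, t, v]])),
    clause5 (\<lambda>F R d u v. (pjdg j_join [PPair F R, PPair u v], [pjdg j_rt [R, u, d], pjdg j_rt [R, v, d]]))]"

definition provable :: "nat \<Rightarrow> bool" where
  "provable = horn trs_clauses"

section \<open>Introduction rules for the judgements\<close>

lemma provableI:
  assumes "i < length trs_clauses" "x = inst (list_encode \<rho>) (fst (trs_clauses ! i))"
    "list_all provable (map (inst (list_encode \<rho>)) (snd (trs_clauses ! i)))"
  shows "provable x"
  using assms nth_mem[OF assms(1)] horn.horn[of _ "snd (trs_clauses ! i)"]
  unfolding provable_def list_all_iff by (metis imageI list.set_map prod.collapse)

lemma provable_neq_clauses:
  "provable (jdg j_neq [0, Suc b])"
  "provable (jdg j_neq [Suc a, 0])"
  "provable (jdg j_neq [a, b]) \<Longrightarrow> provable (jdg j_neq [Suc a, Suc b])"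
  subgoal by (rule provableI[of 0 _ "[b]"]) (simp_all add: trs_clauses_def)
  subgoal by (rule provableI[of 1 _ "[a]"]) (simp_all add: trs_clauses_def)
  subgoal by (rule provableI[of 2 _ "[a, b]"]) (simp_all add: trs_clauses_def)
  done

lemma provable_mem_clauses:
  "provable (jdg j_mem [a, cons_code a l])"
  "provable (jdg j_mem [a, l]) \<Longrightarrow> provable (jdg j_mem [a, cons_code b l])"
  subgoal by (rule provableI[of 3 _ "[a, l]"]) (simp_all add: trs_clauses_def)
  subgoal by (rule provableI[of 4 _ "[a, b, l]"]) (simp_all add: trs_clauses_def)
  done

lemma provable_fresh_clauses:
  "provable (jdg j_fresh [f, 0])"
  "provable (jdg j_neq [f, g]) \<Longrightarrow>
    provable (jdg j_fresh [f, l]) \<Longrightarrow>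
    provable (jdg j_fresh [f, cons_code (pair_code g k) l])"
  subgoal by (rule provableI[of 5 _ "[f]"]) (simp_all add: trs_clauses_def)
  subgoal by (rule provableI[of 6 _ "[f, g, k, l]"]) (simp_all add: trs_clauses_def)
  done

lemma provable_dist_clauses:
  "provable (jdg j_dist [0])"
  "provable (jdg j_fresh [f, l]) \<Longrightarrow>
    provable (jdg j_dist [l]) \<Longrightarrow>
    provable (jdg j_dist [cons_code (pair_code f k) l])"
  subgoal by (rule provableI[of 7 _ "[]"]) (simp_all add: trs_clauses_def)
  subgoal by (rule provableI[of 8 _ "[f, k, l]"]) (simp_all add: trs_clauses_def)
  done

lemma provable_wft_clauses:
  "provable (jdg j_wft [F, var_code x])"
  "provable (jdg j_mem [pair_code f k, F]) \<Longrightarrow>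
    provable (jdg j_wfl [F, k, l]) \<Longrightarrow>
    provable (jdg j_wft [F, fun_code f l])"
  subgoal by (rule provableI[of 9 _ "[F, x]"]) (simp_all add: trs_clauses_def)
  subgoal by (rule provableI[of 10 _ "[F, f, k, l]"]) (simp_all add: trs_clauses_def)
  done

lemma provable_wfl_clauses:
  "provable (jdg j_wfl [F, 0, 0])"
  "provable (jdg j_wft [F, t]) \<Longrightarrow>
    provable (jdg j_wfl [F, k, l]) \<Longrightarrow>
    provable (jdg j_wfl [F, Suc k, cons_code t l])"
  subgoal by (rule provableI[of 11 _ "[F]"]) (simp_all add: trs_clauses_def)
  subgoal by (rule provableI[of 12 _ "[F, k, t, l]"]) (simp_all add: trs_clauses_def)
  done

lemma provable_occ_clauses:
  "provable (jdg j_occ [x, var_code x])"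
  "provable (jdg j_mem [t, l]) \<Longrightarrow>
    provable (jdg j_occ [x, t]) \<Longrightarrow>
    provable (jdg j_occ [x, fun_code f l])"
  subgoal by (rule provableI[of 13 _ "[x]"]) (simp_all add: trs_clauses_def)
  subgoal by (rule provableI[of 14 _ "[x, f, t, l]"]) (simp_all add: trs_clauses_def)
  done

lemma provable_sub_clauses:
  "provable (jdg j_occ [x, u]) \<Longrightarrow> provable (jdg j_sub [u, var_code x])"
  "provable (jdg j_subl [u, l]) \<Longrightarrow> provable (jdg j_sub [u, fun_code f l])"
  subgoal by (rule provableI[of 15 _ "[u, x]"]) (simp_all add: trs_clauses_def)
  subgoal by (rule provableI[of 16 _ "[u, f, l]"]) (simp_all add: trs_clauses_def)
  done

lemma provable_subl_clauses:
  "provable (jdg j_subl [u, 0])"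
  "provable (jdg j_sub [u, t]) \<Longrightarrow>
    provable (jdg j_subl [u, l]) \<Longrightarrow>
    provable (jdg j_subl [u, cons_code t l])"
  subgoal by (rule provableI[of 17 _ "[u]"]) (simp_all add: trs_clauses_def)
  subgoal by (rule provableI[of 18 _ "[u, t, l]"]) (simp_all add: trs_clauses_def)
  done

lemma provable_rules_clauses:
  "provable (jdg j_rules [F, 0])"
  "provable (jdg j_wft [F, fun_code f l]) \<Longrightarrow>
    provable (jdg j_wft [F, r]) \<Longrightarrow>
    provable (jdg j_sub [fun_code f l, r]) \<Longrightarrow>
    provable (jdg j_rules [F, R]) \<Longrightarrow>
    provable (jdg j_rules [F, cons_code (pair_code (fun_code f l) r) R])"
  subgoal by (rule provableI[of 19 _ "[F]"]) (simp_all add: trs_clauses_def)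
  subgoal by (rule provableI[of 20 _ "[F, f, l, r, R]"]) (simp_all add: trs_clauses_def)
  done

lemma provable_wf_clauses:
  "provable (jdg j_dist [F]) \<Longrightarrow>
    provable (jdg j_rules [F, R]) \<Longrightarrow>
    provable (jdg j_wf [pair_code F R])"
  subgoal by (rule provableI[of 21 _ "[F, R]"]) (simp_all add: trs_clauses_def)
  done

lemma provable_nth_clauses:
  "provable (jdg j_nth [cons_code s l, 0, s])"
  "provable (jdg j_nth [l, x, s]) \<Longrightarrow> provable (jdg j_nth [cons_code t l, Suc x, s])"
  subgoal by (rule provableI[of 22 _ "[s, l]"]) (simp_all add: trs_clauses_def)
  subgoal by (rule provableI[of 23 _ "[s, t, x, l]"]) (simp_all add: trs_clauses_def)
  done

lemma provable_sb_clauses: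
  "provable (jdg j_nth [e, x, s]) \<Longrightarrow> provable (jdg j_sb [e, var_code x, s])"
  "provable (jdg j_sbl [e, l, m]) \<Longrightarrow> provable (jdg j_sb [e, fun_code f l, fun_code f m])"
  subgoal by (rule provableI[of 24 _ "[e, x, s]"]) (simp_all add: trs_clauses_def)
  subgoal by (rule provableI[of 25 _ "[e, f, l, m]"]) (simp_all add: trs_clauses_def)
  done

lemma provable_sbl_clauses:
  "provable (jdg j_sbl [e, 0, 0])"
  "provable (jdg j_sb [e, s, t]) \<Longrightarrow>
    provable (jdg j_sbl [e, l, m]) \<Longrightarrow>
    provable (jdg j_sbl [e, cons_code s l, cons_code t m])"
  subgoal by (rule provableI[of 26 _ "[e]"]) (simp_all add: trs_clauses_def)
  subgoal by (rule provableI[of 27 _ "[e, s, t, l, m]"]) (simp_all add: trs_clauses_def)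
  done

lemma provable_rs_clauses:
  "provable (jdg j_mem [pair_code l r, R]) \<Longrightarrow>
    provable (jdg j_sb [e, l, s]) \<Longrightarrow>
    provable (jdg j_sb [e, r, t]) \<Longrightarrow>
    provable (jdg j_rs [R, s, t])"
  "provable (jdg j_rsl [R, l, m]) \<Longrightarrow> provable (jdg j_rs [R, fun_code f l, fun_code f m])"
  subgoal by (rule provableI[of 28 _ "[R, e, l, r, s, t]"]) (simp_all add: trs_clauses_def)
  subgoal by (rule provableI[of 29 _ "[R, f, l, m]"]) (simp_all add: trs_clauses_def)
  done

lemma provable_rsl_clauses:
  "provable (jdg j_rs [R, s, t]) \<Longrightarrow> provable (jdg j_rsl [R, cons_code s l, cons_code t l])"
  "provable (jdg j_rsl [R, l, m]) \<Longrightarrow> provable (jdg j_rsl [R, cons_code s l, cons_code s m])"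
  subgoal by (rule provableI[of 30 _ "[R, s, t, l]"]) (simp_all add: trs_clauses_def)
  subgoal by (rule provableI[of 31 _ "[R, s, l, m]"]) (simp_all add: trs_clauses_def)
  done

lemma provable_rt_clauses:
  "provable (jdg j_rt [R, s, s])"
  "provable (jdg j_rs [R, s, t]) \<Longrightarrow>
    provable (jdg j_rt [R, t, u]) \<Longrightarrow>
    provable (jdg j_rt [R, s, u])"
  subgoal by (rule provableI[of 32 _ "[R, s]"]) (simp_all add: trs_clauses_def)
  subgoal by (rule provableI[of 33 _ "[R, s, t, u]"]) (simp_all add: trs_clauses_def)
  done

lemma provable_peak_clauses:
  "provable (jdg j_wft [F, t]) \<Longrightarrow>
    provable (jdg j_sub [fun_code 0 0, t]) \<Longrightarrow>
    provable (jdg j_rs [R, t, u]) \<Longrightarrow>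
    provable (jdg j_rs [R, t, v]) \<Longrightarrow>
    provable (jdg j_peak [pair_code F R, pair_code u v])"
  subgoal by (rule provableI[of 34 _ "[F, R, t, u, v]"]) (simp_all add: trs_clauses_def)
  done

lemma provable_join_clauses:
  "provable (jdg j_rt [R, u, d]) \<Longrightarrow>
    provable (jdg j_rt [R, v, d]) \<Longrightarrow>
    provable (jdg j_join [pair_code F R, pair_code u v])"
  subgoal by (rule provableI[of 35 _ "[F, R, d, u, v]"]) (simp_all add: trs_clauses_def)
  done

section \<open>Decoding numbers into terms and rewrite systems\<close>

lemma less_list_encode: "x \<in> set xs \<Longrightarrow> x < list_encode xs"
proof (induction xs)
  case (Cons y ys)
  then show ?case
    using le_prod_encode_1[of y "list_encode ys"] le_prod_encode_2[of "list_encode ys" y] by auto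
qed simp

lemma encode_term_eq_iff [simp]: "encode_term s = encode_term t \<longleftrightarrow> s = t"
proof (induction s arbitrary: t)
  case (Var x)
  then show ?case by (cases t) auto
next
  case (Fun f ss)
  show ?case
  proof (cases t)
    case (Fun g ts)
    have "map encode_term ss = map encode_term ts \<longleftrightarrow> ss = ts"
      using Fun.IH by (metis list.inj_map_strong)
    with Fun show ?thesis by (auto simp: list_encode_eq)
  qed simp
qed

text \<open>With injectivity this makes the encoding a bijection, so clause variables, which range
  over all numbers, always denote terms. Strong induction works because the entries of a list are
  smaller than its code.\<close>

lemma encode_term_surj: "\<exists>t. encode_term t = n"
proof (induction n rule: less_induct)
  case (less n)
  obtain k m where n: "n = pair_code k m" by (metis prod_decode_inverse surj_pair)
  show ?case
  proof (cases k)
    case 0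
    then show ?thesis by (intro exI[of _ "Var m"]) (simp add: n)
  next
    case (Suc f)
    have "\<exists>t. encode_term t = x" if "x \<in> set (list_decode m)" for x
      using that less_list_encode[of x "list_decode m"] le_prod_encode_2[of m k]
      by (intro less.IH) (simp add: n)
    then have "\<exists>ts. map encode_term ts = list_decode m"
      using ex_map_conv[of "list_decode m" encode_term] by metis
    then obtain ts where "map encode_term ts = list_decode m" by blast
    then show ?thesis by (intro exI[of _ "Fun f ts"]) (simp add: n Suc)
  qed
qed

definition decode_term :: "nat \<Rightarrow> trm" where
  "decode_term = inv encode_term"

lemma encode_decode_term [simp]: "encode_term (decode_term n) = n"
  unfolding decode_term_def by (metis encode_term_surj f_inv_into_f rangeI)

lemma decode_encode_term [simp]: "decode_term (encode_term t) = t"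
  using encode_decode_term encode_term_eq_iff by blast

definition decode_terms :: "nat \<Rightarrow> trm list" where
  "decode_terms l = map decode_term (list_decode l)"

lemma decode_terms_simps [simp]:
  "decode_terms 0 = []"
  "decode_terms (cons_code t l) = decode_term t # decode_terms l"
  by (simp_all add: decode_terms_def)

lemma map_encode_decode [simp]: "map (encode_term \<circ> decode_term) xs = xs"
  by (induction xs) simp_all

lemma decode_term_simps [simp]:
  "decode_term (var_code x) = Var x"
  "decode_term (fun_code f l) = Fun f (decode_terms l)"
proof -
  show "decode_term (var_code x) = Var x"
    by (simp flip: encode_term_eq_iff)
  show "decode_term (fun_code f l) = Fun f (decode_terms l)"
    by (simp flip: encode_term_eq_iff add: decode_terms_def)
qed

definition decode_sig :: "nat \<Rightarrow> signature" where
  "decode_sig n = map prod_decode (list_decode n)"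

definition decode_rules :: "nat \<Rightarrow> (trm \<times> trm) list" where
  "decode_rules n = map (\<lambda>z. (decode_term (pfst z), decode_term (psnd z))) (list_decode n)"

definition decode_trs :: "nat \<Rightarrow> trs" where
  "decode_trs n = (decode_sig (pfst n), decode_rules (psnd n))"

lemma decode_sig_simps [simp]:
  "decode_sig 0 = []"
  "decode_sig (cons_code z l) = prod_decode z # decode_sig l"
  by (simp_all add: decode_sig_def)

lemma decode_rules_simps [simp]:
  "decode_rules 0 = []"
  "decode_rules (cons_code z l) = (decode_term (pfst z), decode_term (psnd z)) # decode_rules l"
  by (simp_all add: decode_rules_def)

lemma encode_decode_trs [simp]: "encode_trs (decode_trs n) = n"
proof -
  have 1: "map (prod_encode \<circ> prod_decode) xs = xs" for xs
    by (induction xs) simp_all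
  have 2: "map ((\<lambda>(l, r). pair_code (encode_term l) (encode_term r)) \<circ>
      (\<lambda>z. (decode_term (pfst z), decode_term (psnd z)))) xs = xs" for xs
    by (induction xs) simp_all
  show ?thesis
    by (simp add: encode_trs_def decode_trs_def decode_sig_def decode_rules_def 1 2)
qed

lemma encode_trs_inject: "encode_trs R = encode_trs S \<longleftrightarrow> R = S"
proof -
  have "inj (\<lambda>(l, r). pair_code (encode_term l) (encode_term r))"
    by (auto intro!: injI)
  then show ?thesis
    unfolding encode_trs_def
    by (auto simp: list_encode_eq inj_prod_encode intro: prod_eqI)
qed

lemma decode_encode_trs [simp]: "decode_trs (encode_trs R) = R"
  using encode_decode_trs encode_trs_inject by blast

lemma WGCR_codes_iff:
  "n \<in> WGCR_codes \<longleftrightarrow> wf_trs (decode_trs n) \<and> weakly_ground_confluent (decode_trs n)"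
  unfolding WGCR_codes_def mem_Collect_eq using encode_decode_trs decode_encode_trs by metis

section \<open>Soundness of the clauses\<close>

definition rule_ok :: "signature \<Rightarrow> trm \<Rightarrow> trm \<Rightarrow> bool" where
  "rule_ok F l r \<longleftrightarrow> wf_term F l \<and> wf_term F r \<and> (\<forall>x. l \<noteq> Var x) \<and> vars r \<subseteq> vars l"

lemma rule_ok_Fun:
  "rule_ok F (Fun f ls) r \<longleftrightarrow> wf_term F (Fun f ls) \<and> wf_term F r \<and> vars r \<subseteq> vars (Fun f ls)"
  by (simp add: rule_ok_def)

lemma wf_trs_iff:
  "wf_trs (F, R) \<longleftrightarrow> distinct (map fst F) \<and> (\<forall>(l, r) \<in> set R. rule_ok F l r)"
  by (auto simp: wf_trs_def rule_ok_def)

text \<open>The rewrite relation depends on the rules alone, so the rewriting judgements carry only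
  the code of the rule list and are read with an empty signature.\<close>

lemma rstep_snd:
  assumes "snd R = snd S"
  shows "rstep R = rstep S"
proof -
  have *: "rstep S s t" if "rstep R s t" "snd R = snd S" for R S s t
    using that by (induction) (auto intro: rstep.intros)
  have "rstep R s t \<longleftrightarrow> rstep S s t" for s t
    using *[of R s t S] *[of S s t R] assms by auto
  then show ?thesis by blast
qed

abbreviation rstep_code :: "nat \<Rightarrow> trm \<Rightarrow> trm \<Rightarrow> bool" where
  "rstep_code R \<equiv> rstep ([], decode_rules R)"

text \<open>The reading of \<open>j_rsl\<close>: one argument makes one step.\<close>

definition args_step :: "nat \<Rightarrow> trm list \<Rightarrow> trm list \<Rightarrow> bool" where
  "args_step R ts us \<longleftrightarrow> (\<exists>i u. i < length ts \<and> rstep_code R (ts ! i) u \<and> us = ts[i := u])"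

lemma args_step_Cons1: "rstep_code R s t \<Longrightarrow> args_step R (s # ts) (t # ts)"
  unfolding args_step_def by (intro exI[of _ 0]) auto

lemma args_step_Cons2: "args_step R ts us \<Longrightarrow> args_step R (s # ts) (s # us)"
  unfolding args_step_def by (metis length_Cons Suc_less_eq nth_Cons_Suc list_update_code(3))

lemma args_step_Fun: "args_step R ts us \<Longrightarrow> rstep_code R (Fun f ts) (Fun f us)"
  unfolding args_step_def by (auto intro: rstep.ctxt)

text \<open>A list of term codes read as a substitution; positions beyond its end yield some
  unspecified term.\<close>

abbreviation subst_code :: "nat \<Rightarrow> nat \<Rightarrow> trm" where
  "subst_code e \<equiv> \<lambda>x. decode_term (list_decode e ! x)"

text \<open>The intended reading of each judgement, given for arbitrary argument codes so that it
  can be the invariant of an induction over \<open>horn\<close>. Unknown tags are false.\<close>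

definition meaning :: "nat \<Rightarrow> nat list \<Rightarrow> bool" where
  "meaning k as =
    (if k = j_neq then as ! 0 \<noteq> as ! 1
     else if k = j_mem then as ! 0 \<in> set (list_decode (as ! 1))
     else if k = j_fresh then as ! 0 \<notin> fst ` set (decode_sig (as ! 1))
     else if k = j_dist then distinct (map fst (decode_sig (as ! 0)))
     else if k = j_wft then wf_term (decode_sig (as ! 0)) (decode_term (as ! 1))
     else if k = j_wfl then length (decode_terms (as ! 2)) = as ! 1 \<and>
       (\<forall>t \<in> set (decode_terms (as ! 2)). wf_term (decode_sig (as ! 0)) t)
     else if k = j_occ then as ! 0 \<in> vars (decode_term (as ! 1))
     else if k = j_sub then vars (decode_term (as ! 1)) \<subseteq> vars (decode_term (as ! 0))
     else if k = j_subl then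
       (\<forall>t \<in> set (decode_terms (as ! 1)). vars t \<subseteq> vars (decode_term (as ! 0)))
     else if k = j_rules then \<forall>(l, r) \<in> set (decode_rules (as ! 1)). rule_ok (decode_sig (as ! 0)) l r
     else if k = j_wf then wf_trs (decode_trs (as ! 0))
     else if k = j_nth then list_decode (as ! 0) ! (as ! 1) = as ! 2
     else if k = j_sb then subst (subst_code (as ! 0)) (decode_term (as ! 1)) = decode_term (as ! 2)
     else if k = j_sbl then
       map (subst (subst_code (as ! 0))) (decode_terms (as ! 1)) = decode_terms (as ! 2)
     else if k = j_rs then rstep_code (as ! 0) (decode_term (as ! 1)) (decode_term (as ! 2))
     else if k = j_rsl then args_step (as ! 0) (decode_terms (as ! 1)) (decode_terms (as ! 2))
     else if k = j_rt then
       (rstep_code (as ! 0))\<^sup>*\<^sup>* (decode_term (as ! 1)) (decode_term (as ! 2))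
     else if k = j_peak then \<exists>t. ground t \<and> wf_term (fst (decode_trs (as ! 0))) t \<and>
       rstep (decode_trs (as ! 0)) t (decode_term (pfst (as ! 1))) \<and>
       rstep (decode_trs (as ! 0)) t (decode_term (psnd (as ! 1)))
     else if k = j_join then \<exists>d. (rstep (decode_trs (as ! 0)))\<^sup>*\<^sup>* (decode_term (pfst (as ! 1))) d \<and>
       (rstep (decode_trs (as ! 0)))\<^sup>*\<^sup>* (decode_term (psnd (as ! 1))) d
     else False)"

definition true_judgement :: "nat \<Rightarrow> bool" where
  "true_judgement x \<longleftrightarrow> meaning (pfst x) (list_decode (psnd x))"

lemma true_judgement_jdg [simp]: "true_judgement (jdg k as) = meaning k as"
  by (simp add: true_judgement_def jdg_def)

lemma decode_sig_mem: "z \<in> set (list_decode F) \<Longrightarrow> prod_decode z \<in> set (decode_sig F)"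
  by (simp add: decode_sig_def)

lemma decode_rules_mem:
  "z \<in> set (list_decode R) \<Longrightarrow> (decode_term (pfst z), decode_term (psnd z)) \<in> set (decode_rules R)"
  by (simp add: decode_rules_def)

lemma decode_terms_mem: "t \<in> set (list_decode l) \<Longrightarrow> decode_term t \<in> set (decode_terms l)"
  by (simp add: decode_terms_def)

lemma rstep_decode_trs: "rstep (decode_trs n) = rstep_code (psnd n)"
  by (rule rstep_snd) (simp add: decode_trs_def)

lemma rstep_code_root:
  assumes "pair_code l r \<in> set (list_decode R)" "subst \<sigma> (decode_term l) = s" "subst \<sigma> (decode_term r) = t"
  shows "rstep_code R s t"
  using rstep.root[of "decode_term l" "decode_term r" "([], decode_rules R)" \<sigma>]
    decode_rules_mem[OF assms(1)] assms(2,3) by simp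

text \<open>The true judgements form a model of the clauses; \<open>horn\<close> is the least model,
  so it contains true judgements only.\<close>

lemma trs_clauses_sound:
  "\<forall>C \<in> set trs_clauses. \<forall>\<rho>. list_all true_judgement (map (inst \<rho>) (snd C)) \<longrightarrow>
     true_judgement (inst \<rho> (fst C))"
  unfolding trs_clauses_def
  apply (simp only: list.set ball_simps simp_thms)
  apply (intro conjI allI impI)
  apply (simp_all add: meaning_def rstep_decode_trs)
  apply (auto simp: rule_ok_Fun wf_trs_iff decode_trs_def ground_def
      intro: rstep_code_root args_step_Fun args_step_Cons1 args_step_Cons2 converse_rtranclp_into_rtranclp
      dest: decode_sig_mem decode_terms_mem)
  done

lemma provable_sound: "provable x \<Longrightarrow> true_judgement x"
  unfolding provable_def
proof (induction rule: horn.induct)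
  case (horn c ps \<rho>)
  then show ?case using trs_clauses_sound by (fastforce simp: list_all_iff)
qed

section \<open>Completeness of the clauses\<close>

lemma provable_neq: "a \<noteq> b \<Longrightarrow> provable (jdg j_neq [a, b])"
proof (induction a arbitrary: b)
  case 0
  then show ?case by (cases b) (auto intro: provable_neq_clauses)
next
  case (Suc a)
  then show ?case by (cases b) (auto intro: provable_neq_clauses)
qed

lemma provable_mem: "a \<in> set xs \<Longrightarrow> provable (jdg j_mem [a, list_encode xs])"
  by (induction xs) (auto intro: provable_mem_clauses)

lemma provable_fresh:
  "f \<notin> fst ` set F \<Longrightarrow> provable (jdg j_fresh [f, list_encode (map prod_encode F)])"
  by (induction F) (auto intro!: provable_fresh_clauses provable_neq)

lemma provable_dist:
  "distinct (map fst F) \<Longrightarrow> provable (jdg j_dist [list_encode (map prod_encode F)])"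
  by (induction F) (force intro!: provable_dist_clauses provable_fresh)+

lemma provable_wfl:
  "(\<And>t. t \<in> set ts \<Longrightarrow> provable (jdg j_wft [F, encode_term t])) \<Longrightarrow>
    provable (jdg j_wfl [F, length ts, list_encode (map encode_term ts)])"
  by (induction ts) (auto intro!: provable_wfl_clauses)

lemma provable_wft:
  "wf_term F t \<Longrightarrow> provable (jdg j_wft [list_encode (map prod_encode F), encode_term t])"
proof (induction t)
  case (Var x)
  then show ?case by (auto intro: provable_wft_clauses)
next
  case (Fun f ts)
  then have "provable (jdg j_mem [pair_code f (length ts), list_encode (map prod_encode F)])"
    by (intro provable_mem) auto
  moreover have "provable (jdg j_wfl [list_encode (map prod_encode F), length ts,
      list_encode (map encode_term ts)])"
    using Fun by (intro provable_wfl) auto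
  ultimately show ?case by (auto intro: provable_wft_clauses)
qed

lemma provable_occ: "x \<in> vars t \<Longrightarrow> provable (jdg j_occ [x, encode_term t])"
proof (induction t)
  case (Var y)
  then show ?case by (auto intro: provable_occ_clauses)
next
  case (Fun f ts)
  then obtain t where "t \<in> set ts" "x \<in> vars t" by auto
  then have "provable (jdg j_mem [encode_term t, list_encode (map encode_term ts)])"
    "provable (jdg j_occ [x, encode_term t])"
    using Fun.IH by (auto intro: provable_mem)
  then show ?case by (auto intro: provable_occ_clauses)
qed

lemma provable_subl:
  "(\<And>t. t \<in> set ts \<Longrightarrow> provable (jdg j_sub [u, encode_term t])) \<Longrightarrow>
    provable (jdg j_subl [u, list_encode (map encode_term ts)])"
  by (induction ts) (auto intro!: provable_subl_clauses)

lemma provable_sub: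
  "vars t \<subseteq> vars u \<Longrightarrow> provable (jdg j_sub [encode_term u, encode_term t])"
proof (induction t)
  case (Var x)
  then show ?case by (auto intro: provable_sub_clauses provable_occ)
next
  case (Fun f ts)
  then have "provable (jdg j_subl [encode_term u, list_encode (map encode_term ts)])"
    by (intro provable_subl) auto
  then show ?case by (auto intro: provable_sub_clauses)
qed

abbreviation encode_rules :: "(trm \<times> trm) list \<Rightarrow> nat" where
  "encode_rules R \<equiv> list_encode (map (\<lambda>(l, r). pair_code (encode_term l) (encode_term r)) R)"

lemma provable_rules:
  "\<forall>(l, r) \<in> set R. rule_ok F l r \<Longrightarrow>
    provable (jdg j_rules [list_encode (map prod_encode F), encode_rules R])"
proof (induction R)
  case Nil
  then show ?case by (auto intro: provable_rules_clauses)
next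
  case (Cons lr R)
  obtain l r where lr: "lr = (l, r)" by fastforce
  then have ok: "rule_ok F l r" using Cons.prems by simp
  then obtain f ls where l: "l = Fun f ls" by (cases l) (auto simp: rule_ok_def)
  have "provable (jdg j_wft [list_encode (map prod_encode F), encode_term l])"
    "provable (jdg j_wft [list_encode (map prod_encode F), encode_term r])"
    "provable (jdg j_sub [encode_term l, encode_term r])"
    using ok unfolding rule_ok_def by (blast intro: provable_wft provable_sub)+
  then show ?case
    using Cons by (simp add: lr l provable_rules_clauses)
qed

lemma provable_wf: "wf_trs R \<Longrightarrow> provable (jdg j_wf [encode_trs R])"
  by (cases R) (auto simp: wf_trs_iff encode_trs_def intro!: provable_wf_clauses provable_dist provable_rules)

lemma provable_nth:
  "x < length xs \<Longrightarrow> provable (jdg j_nth [list_encode xs, x, xs ! x])"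
proof (induction xs arbitrary: x)
  case (Cons y ys)
  then show ?case by (cases x) (auto intro: provable_nth_clauses)
qed simp

lemma provable_sbl:
  "(\<And>t. t \<in> set ts \<Longrightarrow> provable (jdg j_sb [e, encode_term t, encode_term (subst \<sigma> t)])) \<Longrightarrow>
    provable (jdg j_sbl [e, list_encode (map encode_term ts),
      list_encode (map encode_term (map (subst \<sigma>) ts))])"
  by (induction ts) (auto intro!: provable_sbl_clauses)

text \<open>A substitution is an infinite object, but its values on the variables below
  \<open>N\<close> fit into a list and determine its effect on \<open>t\<close>.\<close>

lemma provable_sb:
  "vars t \<subseteq> {..<N} \<Longrightarrow> provable (jdg j_sb [list_encode (map (\<lambda>x. encode_term (\<sigma> x)) [0..<N]),
     encode_term t, encode_term (subst \<sigma> t)])"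
proof (induction t)
  case (Var x)
  then show ?case
    using provable_nth[of x "map (\<lambda>x. encode_term (\<sigma> x)) [0..<N]"]
    by (auto intro: provable_sb_clauses)
next
  case (Fun f ts)
  from provable_sbl[of ts "list_encode (map (\<lambda>x. encode_term (\<sigma> x)) [0..<N])" \<sigma>] Fun
  show ?case by (auto intro!: provable_sb_clauses)
qed

lemma finite_vars: "finite (vars t)"
  by (induction t) auto

lemma provable_rsl:
  "i < length ts \<Longrightarrow> provable (jdg j_rs [R, encode_term (ts ! i), encode_term u]) \<Longrightarrow>
    provable (jdg j_rsl [R, list_encode (map encode_term ts),
      list_encode (map encode_term (ts[i := u]))])"
proof (induction ts arbitrary: i)
  case (Cons t ts)
  then show ?case by (cases i) (auto intro!: provable_rsl_clauses)
qed simp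

lemma provable_rs:
  "rstep R s t \<Longrightarrow> provable (jdg j_rs [encode_rules (snd R), encode_term s, encode_term t])"
proof (induction rule: rstep.induct)
  case (root l r \<sigma>)
  \<comment> \<open>One bound for both sides of the rule, so that the same list represents the
    substitution in both.\<close>
  have "finite (vars l \<union> vars r)" by (simp add: finite_vars)
  then obtain N where "\<forall>x \<in> vars l \<union> vars r. x < N" using finite_nat_set_iff_bounded by blast
  then have N: "vars l \<subseteq> {..<N}" "vars r \<subseteq> {..<N}" by auto
  have "provable (jdg j_mem [pair_code (encode_term l) (encode_term r), encode_rules (snd R)])"
    using root by (intro provable_mem) force
  from provable_rs_clauses(1)[OF this provable_sb[OF N(1)] provable_sb[OF N(2)]] show ?case .
next
  case (ctxt s t i ts f)
  then show ?case by (simp add: provable_rs_clauses provable_rsl)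
qed

lemma provable_rt:
  "(rstep R)\<^sup>*\<^sup>* s t \<Longrightarrow> provable (jdg j_rt [encode_rules (snd R), encode_term s, encode_term t])"
  by (induction rule: converse_rtranclp_induct) (blast intro: provable_rt_clauses provable_rs)+

lemma provable_peak:
  assumes "ground t" "wf_term (fst R) t" "rstep R t u" "rstep R t v"
  shows "provable (jdg j_peak [encode_trs R, pair_code (encode_term u) (encode_term v)])"
proof -
  \<comment> \<open>Groundness is expressed as inclusion in the empty variable set of a
    constant.\<close>
  have "provable (jdg j_sub [encode_term (Fun 0 []), encode_term t])"
    using assms(1) by (intro provable_sub) (simp add: ground_def)
  then show ?thesis
    unfolding encode_trs_def using assms(2-4)
    by (intro provable_peak_clauses[where t = "encode_term t"]) (auto intro: provable_rs provable_wft)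
qed

lemma provable_join:
  assumes "(rstep R)\<^sup>*\<^sup>* u d" "(rstep R)\<^sup>*\<^sup>* v d"
  shows "provable (jdg j_join [encode_trs R, pair_code (encode_term u) (encode_term v)])"
  unfolding encode_trs_def using assms
  by (intro provable_join_clauses[where d = "encode_term d"] provable_rt)

section \<open>Membership in \<open>Pi02\<close>\<close>

lemma provable_wf_iff: "provable (jdg j_wf [n]) \<longleftrightarrow> wf_trs (decode_trs n)"
  using provable_sound[of "jdg j_wf [n]"] provable_wf[of "decode_trs n"]
  by (auto simp: meaning_def)

lemma provable_peak_iff:
  "provable (jdg j_peak [n, p]) \<longleftrightarrow> (\<exists>t. ground t \<and> wf_term (fst (decode_trs n)) t \<and>
     rstep (decode_trs n) t (decode_term (pfst p)) \<and> rstep (decode_trs n) t (decode_term (psnd p)))"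
proof
  assume "provable (jdg j_peak [n, p])"
  from provable_sound[OF this] show "\<exists>t. ground t \<and> wf_term (fst (decode_trs n)) t \<and>
     rstep (decode_trs n) t (decode_term (pfst p)) \<and> rstep (decode_trs n) t (decode_term (psnd p))"
    by (simp add: meaning_def)
next
  assume "\<exists>t. ground t \<and> wf_term (fst (decode_trs n)) t \<and>
     rstep (decode_trs n) t (decode_term (pfst p)) \<and> rstep (decode_trs n) t (decode_term (psnd p))"
  then show "provable (jdg j_peak [n, p])"
    using provable_peak[of _ "decode_trs n" "decode_term (pfst p)" "decode_term (psnd p)"] by auto
qed

lemma provable_join_iff:
  "provable (jdg j_join [n, p]) \<longleftrightarrow> (\<exists>d. (rstep (decode_trs n))\<^sup>*\<^sup>* (decode_term (pfst p)) d \<and>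
     (rstep (decode_trs n))\<^sup>*\<^sup>* (decode_term (psnd p)) d)"
proof
  assume "provable (jdg j_join [n, p])"
  from provable_sound[OF this] show "\<exists>d. (rstep (decode_trs n))\<^sup>*\<^sup>* (decode_term (pfst p)) d \<and>
     (rstep (decode_trs n))\<^sup>*\<^sup>* (decode_term (psnd p)) d"
    by (simp add: meaning_def)
next
  assume "\<exists>d. (rstep (decode_trs n))\<^sup>*\<^sup>* (decode_term (pfst p)) d \<and>
     (rstep (decode_trs n))\<^sup>*\<^sup>* (decode_term (psnd p)) d"
  then show "provable (jdg j_join [n, p])"
    using provable_join[of "decode_trs n" "decode_term (pfst p)" _ "decode_term (psnd p)"] by auto
qed

text \<open>Every number \<open>p\<close> is a pair of term codes, so ranging over \<open>p\<close>
  covers all pairs in which a peak can end; the source of the peak and the common reduct are hidden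
  inside the two judgements.\<close>

lemma WGCR_codes_iff_provable:
  "n \<in> WGCR_codes \<longleftrightarrow> provable (jdg j_wf [n]) \<and>
     (\<forall>p. provable (jdg j_peak [n, p]) \<longrightarrow> provable (jdg j_join [n, p]))"
proof -
  have "weakly_ground_confluent (decode_trs n) \<longleftrightarrow>
      (\<forall>p. provable (jdg j_peak [n, p]) \<longrightarrow> provable (jdg j_join [n, p]))" (is "?L \<longleftrightarrow> ?R")
  proof
    assume ?L
    then show ?R
      unfolding provable_peak_iff provable_join_iff weakly_ground_confluent_def weakly_confluent_on_def
      by blast
  next
    assume ?R
    show ?L
      unfolding weakly_ground_confluent_def weakly_confluent_on_def
    proof (intro allI impI)
      fix t u v
      assume "ground t \<and> wf_term (fst (decode_trs n)) t"
        "rstep (decode_trs n) t u \<and> rstep (decode_trs n) t v"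
      with \<open>?R\<close>[rule_format, of "pair_code (encode_term u) (encode_term v)"]
      show "\<exists>d. (rstep (decode_trs n))\<^sup>*\<^sup>* u d \<and> (rstep (decode_trs n))\<^sup>*\<^sup>* v d"
        unfolding provable_peak_iff provable_join_iff by auto
    qed
  qed
  then show ?thesis by (simp add: WGCR_codes_iff provable_wf_iff)
qed

lemma total_computable_jdg:
  "total_computable f \<Longrightarrow> total_computable (\<lambda>n. jdg k [f n])"
  "total_computable f \<Longrightarrow> total_computable g \<Longrightarrow> total_computable (\<lambda>n. jdg k [f n, g n])"
  unfolding jdg_def list_encode.simps
  by (intro total_computable_pair total_computable_Suc total_computable_const; assumption)+

theorem WGCR_codes_in_Pi02: "WGCR_codes \<in> Pi02"
proof -
  let ?C = "certifies trs_clauses"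
  \<comment> \<open>\<open>x\<close> packs a purported certificate of a peak with the pair in which
    it ends; \<open>y\<close> packs certificates of well-formedness and of a join. Well-formedness
    is treated as a recursively enumerable condition, so its certificate belongs to the existential
    witness.\<close>
  define Q where "Q n x y \<longleftrightarrow> ?C (pfst y) (jdg j_wf [n]) \<and>
    (?C (pfst x) (jdg j_peak [n, psnd x]) \<longrightarrow> ?C (psnd y) (jdg j_join [n, psnd x]))" for n x y
  have "decidable3 Q"
    unfolding Q_def
    by (intro decidable3I decidable_conj decidable_imp decidable_certifies total_computable_jdg
        total_computable_pfst total_computable_psnd total_computable_id)
  moreover have "n \<in> WGCR_codes \<longleftrightarrow> (\<forall>x. \<exists>y. Q n x y)" for n
  proof
    assume n: "n \<in> WGCR_codes"
    then obtain u where u: "?C u (jdg j_wf [n])"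
      unfolding WGCR_codes_iff_provable provable_def horn_iff_certifies by blast
    \<comment> \<open>If \<open>pfst x\<close> certifies no peak, any \<open>v\<close> will do;
      otherwise the peak is genuine and has a certified join.\<close>
    have "\<exists>v. ?C (pfst x) (jdg j_peak [n, psnd x]) \<longrightarrow> ?C v (jdg j_join [n, psnd x])" for x
      using n unfolding WGCR_codes_iff_provable provable_def horn_iff_certifies by blast
    then obtain v where "?C (pfst x) (jdg j_peak [n, psnd x]) \<longrightarrow> ?C (v x) (jdg j_join [n, psnd x])"
      for x by metis
    with u have "Q n x (pair_code u (v x))" for x by (simp add: Q_def)
    then show "\<forall>x. \<exists>y. Q n x y" by blast
  next
    assume Q: "\<forall>x. \<exists>y. Q n x y"
    have "\<exists>w. ?C w (jdg j_join [n, p])" if "?C w (jdg j_peak [n, p])" for w p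
      using Q[rule_format, of "pair_code w p"] that by (auto simp: Q_def)
    moreover have "\<exists>w. ?C w (jdg j_wf [n])"
      using Q by (auto simp: Q_def)
    ultimately show "n \<in> WGCR_codes"
      unfolding WGCR_codes_iff_provable provable_def horn_iff_certifies by blast
  qed
  ultimately show ?thesis unfolding Pi02_def by blast
qed

section \<open>Rewriting with left-linear rules\<close>

abbreviation rsteps :: "trs \<Rightarrow> trm \<Rightarrow> trm \<Rightarrow> bool" where
  "rsteps R \<equiv> (rstep R)\<^sup>*\<^sup>*"

lemma rsteps_ctxt:
  assumes "rsteps R s t"
  shows "rsteps R (Fun f (xs @ s # ys)) (Fun f (xs @ t # ys))"
  using assms
proof induction
  case (step t u)
  have "rstep R (Fun f (xs @ t # ys)) (Fun f ((xs @ t # ys)[length xs := u]))"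
    using step by (intro rstep.ctxt) auto
  with step show ?case by simp
qed simp

lemma rsteps_args:
  assumes "list_all2 (rsteps R) ss ts"
  shows "rsteps R (Fun f ss) (Fun f ts)"
proof -
  \<comment> \<open>Generalised over a prefix \<open>xs\<close> of arguments that have already been
    rewritten.\<close>
  have "rsteps R (Fun f (xs @ ss)) (Fun f (xs @ ts))" for xs
    using assms
  proof (induction arbitrary: xs rule: list_all2_induct)
    case (Cons s ss t ts)
    have "rsteps R (Fun f (xs @ s # ss)) (Fun f (xs @ t # ss))"
      using Cons by (intro rsteps_ctxt)
    also have "rsteps R \<dots> (Fun f (xs @ t # ts))"
      using Cons.IH[of "xs @ [t]"] by simp
    finally show ?case .
  qed simp
  from this[of "[]"] show ?thesis by simp
qed

lemma rsteps_subst: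
  assumes "\<And>x. rsteps R (\<sigma> x) (\<tau> x)"
  shows "rsteps R (subst \<sigma> t) (subst \<tau> t)"
  by (induction t) (auto simp: assms list_all2_conv_all_nth intro!: rsteps_args)

lemma subst_cong: "(\<And>x. x \<in> vars t \<Longrightarrow> \<sigma> x = \<tau> x) \<Longrightarrow> subst \<sigma> t = subst \<tau> t"
  by (induction t) auto

lemma wf_term_subst: "wf_term F (subst \<sigma> t) \<longleftrightarrow> wf_term F t \<and> (\<forall>x \<in> vars t. wf_term F (\<sigma> x))"
  by (induction t) auto

lemma rstep_wf_term:
  assumes "rstep R s t" "wf_trs R" "wf_term (fst R) s"
  shows "wf_term (fst R) t"
  using assms
proof induction
  case (root l r \<sigma>)
  then show ?case unfolding wf_trs_def wf_term_subst by fastforce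
next
  case (ctxt s t i ts f)
  then show ?case by (auto dest!: set_update_subset_insert[THEN subsetD])
qed

fun disjoint_vars :: "trm list \<Rightarrow> bool" where
  "disjoint_vars [] \<longleftrightarrow> True"
| "disjoint_vars (t # ts) \<longleftrightarrow> vars t \<inter> (\<Union>u \<in> set ts. vars u) = {} \<and> disjoint_vars ts"

text \<open>For \<open>C\<close> the set of constructors, these are the linear constructor patterns
  allowed below the root of a left-hand side.\<close>

fun linear_over :: "nat set \<Rightarrow> trm \<Rightarrow> bool" where
  "linear_over C (Var x) \<longleftrightarrow> True"
| "linear_over C (Fun f ts) \<longleftrightarrow> f \<in> C \<and> disjoint_vars ts \<and> (\<forall>t \<in> set ts. linear_over C t)"

lemma disjoint_vars_nth:
  "disjoint_vars ts \<Longrightarrow> i < length ts \<Longrightarrow> j < length ts \<Longrightarrow> i \<noteq> j \<Longrightarrow> vars (ts ! i) \<inter> vars (ts ! j) = {}"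
proof (induction ts arbitrary: i j)
  case (Cons t ts)
  have "vars t \<inter> vars (ts ! k) = {}" if "k < length ts" for k
    using Cons.prems(1) nth_mem[OF that] by auto
  with Cons show ?case by (cases i; cases j) auto
qed simp

definition moved :: "trs \<Rightarrow> (nat \<Rightarrow> trm) \<Rightarrow> (nat \<Rightarrow> trm) \<Rightarrow> bool" where
  "moved R \<sigma> \<tau> \<longleftrightarrow> (\<forall>x. rsteps R (\<sigma> x) (\<tau> x))"

text \<open>The arguments share no variables, so \<open>\<tau>\<close> can act on the variables of
  the rewritten argument while \<open>\<sigma>\<close> is kept elsewhere.\<close>

lemma moved_args:
  assumes "disjoint_vars ts" "i < length ts" "moved R \<sigma> \<tau>" "u = subst \<tau> (ts ! i)"
  shows "\<exists>\<tau>. (map (subst \<sigma>) ts)[i := u] = map (subst \<tau>) ts \<and> moved R \<sigma> \<tau>"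
proof -
  define \<tau>' where "\<tau>' x = (if x \<in> vars (ts ! i) then \<tau> x else \<sigma> x)" for x
  have "(map (subst \<sigma>) ts)[i := u] ! j = subst \<tau>' (ts ! j)" if j: "j < length ts" for j
  proof (cases "j = i")
    case True
    then show ?thesis using assms(2,4) by (auto simp: \<tau>'_def intro: subst_cong)
  next
    case False
    then show ?thesis using disjoint_vars_nth[OF assms(1,2) j] j
      by (auto simp: \<tau>'_def intro!: subst_cong)
  qed
  then have "(map (subst \<sigma>) ts)[i := u] = map (subst \<tau>') ts"
    by (intro nth_equalityI) auto
  moreover have "moved R \<sigma> \<tau>'" using assms(3) by (auto simp: moved_def \<tau>'_def)
  ultimately show ?thesis by blast
qed

text \<open>No left-hand side is rooted in \<open>C\<close>, so no redex starts inside the pattern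
  and the step happens at or below one of its variables. By linearity the result is again an
  instance.\<close>

lemma rstep_linear:
  assumes "\<forall>(l, r) \<in> set (snd R). \<exists>f ls. l = Fun f ls \<and> f \<notin> C"
    and "linear_over C t" "rstep R (subst \<sigma> t) u"
  shows "\<exists>\<tau>. u = subst \<tau> t \<and> moved R \<sigma> \<tau>"
  using assms(2,3)
proof (induction t arbitrary: u)
  case (Var x)
  then show ?case
    by (intro exI[of _ "\<sigma>(x := u)"]) (auto simp: moved_def)
next
  case (Fun f ts)
  from Fun.prems(2) show ?case
  proof cases
    case (root l r \<sigma>')
    then show ?thesis using assms(1) Fun.prems(1) by fastforce
  next
    case (ctxt s t i ss g)
    then have "i < length ts" "rstep R (subst \<sigma> (ts ! i)) t" "linear_over C (ts ! i)" "ts ! i \<in> set ts"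
      using Fun.prems(1) by auto
    then obtain \<tau> where "moved R \<sigma> \<tau>" "t = subst \<tau> (ts ! i)" using Fun.IH by blast
    from moved_args[OF _ \<open>i < length ts\<close> this] show ?thesis using ctxt Fun.prems(1) by auto
  qed
qed

text \<open>The variable overlap of the critical pair lemma: after the inner step the rule still
  applies, with a moved substitution, and the contractum of the root step catches up by rewriting
  every copy of the moved variables.\<close>

lemma root_inner_join:
  assumes lhs: "\<forall>(l, r) \<in> set (snd R). \<exists>f ls. l = Fun f ls \<and> f \<notin> C"
    and rule: "(Fun f ls, r) \<in> set (snd R)"
    and lin: "disjoint_vars ls" "\<forall>t \<in> set ls. linear_over C t"
    and inner: "i < length ls" "rstep R (subst \<sigma> (ls ! i)) u"
  shows "\<exists>d. rsteps R (subst \<sigma> r) d \<and> rsteps R (Fun f ((map (subst \<sigma>) ls)[i := u])) d"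
proof -
  obtain \<tau> where "moved R \<sigma> \<tau>" "u = subst \<tau> (ls ! i)"
    using rstep_linear[OF lhs _ inner(2)] lin(2) inner(1) by auto
  then obtain \<tau> where \<tau>: "(map (subst \<sigma>) ls)[i := u] = map (subst \<tau>) ls" "moved R \<sigma> \<tau>"
    using moved_args[OF lin(1) inner(1)] by blast
  have "rstep R (Fun f ((map (subst \<sigma>) ls)[i := u])) (subst \<tau> r)"
    using rstep.root[OF rule, of \<tau>] by (simp add: \<tau>(1))
  moreover have "rsteps R (subst \<sigma> r) (subst \<tau> r)"
    using \<tau>(2) by (auto simp: moved_def intro: rsteps_subst)
  ultimately show ?thesis by blast
qed

section \<open>The interpreter\<close>

abbreviation "zT \<equiv> Fun 10 []"
abbreviation "sT t \<equiv> Fun 11 [t]"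
abbreviation "nilT \<equiv> Fun 12 []"
abbreviation "consT t u \<equiv> Fun 13 [t, u]"
abbreviation "zeroP \<equiv> Fun 14 []"
abbreviation "succP \<equiv> Fun 15 []"
abbreviation "projP t \<equiv> Fun 16 [t]"
abbreviation "compP t u \<equiv> Fun 17 [t, u]"
abbreviation "precP t u \<equiv> Fun 18 [t, u]"
abbreviation "muP t \<equiv> Fun 19 [t]"
abbreviation "evT t u \<equiv> Fun 20 [t, u]"
abbreviation "evsT t u \<equiv> Fun 21 [t, u]"
abbreviation "idT t \<equiv> Fun 22 [t]"
abbreviation "loopT t u v w \<equiv> Fun 23 [t, u, v, w]"
abbreviation "startT t \<equiv> Fun 24 [t]"
abbreviation "doneT t \<equiv> Fun 25 [t]"
abbreviation "okT \<equiv> Fun 26 []"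
abbreviation "checkT t u \<equiv> Fun 27 [t, u]"
abbreviation "inzT \<equiv> Fun 28 []"
abbreviation "insT t \<equiv> Fun 29 [t]"

abbreviation (input) defined_symbols :: "nat set" where
  "defined_symbols \<equiv> {20, 21, 22, 23, 24, 25, 27}"

definition interp_sig :: signature where
  "interp_sig = [(10, 0), (11, 1), (12, 0), (13, 2), (14, 0), (15, 0), (16, 1), (17, 2), (18, 2),
    (19, 1), (20, 2), (21, 2), (22, 1), (23, 4), (24, 1), (25, 1), (26, 0), (27, 2), (28, 0), (29, 1)]"

fun num :: "nat \<Rightarrow> trm" where
  "num 0 = zT"
| "num (Suc n) = sT (num n)"

fun innum :: "nat \<Rightarrow> trm" where
  "innum 0 = inzT"
| "innum (Suc n) = insT (innum n)"

fun listT :: "trm list \<Rightarrow> trm" where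
  "listT [] = nilT"
| "listT (t # ts) = consT t (listT ts)"

fun prog :: "recf \<Rightarrow> trm" where
  "prog Zero = zeroP"
| "prog Succ = succP"
| "prog (Proj i) = projP (num i)"
| "prog (Comp f gs) = compP (prog f) (listT (map prog gs))"
| "prog (Prec f g) = precP (prog f) (prog g)"
| "prog (Mu f) = muP (prog f)"

text \<open>Projections and search results are passed through \<open>idT\<close>, which is defined on numerals only:
  a collapsing rule could turn a defined symbol into an input constructor.\<close>

definition interp_rules :: "(trm \<times> trm) list" where
  "interp_rules = [
    (evT zeroP (Var 0), zT),
    (evT succP (consT (Var 0) (Var 1)), sT (Var 0)),
    (evT (projP zT) (consT (Var 0) (Var 1)), idT (Var 0)),
    (evT (projP (sT (Var 0))) (consT (Var 1) (Var 2)), evT (projP (Var 0)) (Var 2)),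
    (evT (compP (Var 0) (Var 1)) (Var 2), evT (Var 0) (evsT (Var 1) (Var 2))),
    (evT (precP (Var 0) (Var 1)) (consT zT (Var 2)), evT (Var 0) (Var 2)),
    (evT (precP (Var 0) (Var 1)) (consT (sT (Var 2)) (Var 3)),
      evT (Var 1) (consT (evT (precP (Var 0) (Var 1)) (consT (Var 2) (Var 3)))
        (consT (Var 2) (Var 3)))),
    (evT (muP (Var 0)) (Var 1), loopT (evT (Var 0) (consT zT (Var 1))) (Var 0) zT (Var 1)),
    (loopT zT (Var 0) (Var 1) (Var 2), idT (Var 1)),
    (loopT (sT (Var 0)) (Var 1) (Var 2) (Var 3),
      loopT (evT (Var 1) (consT (sT (Var 2)) (Var 3))) (Var 1) (sT (Var 2)) (Var 3)),
    (evsT nilT (Var 0), nilT),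
    (evsT (consT (Var 0) (Var 1)) (Var 2), consT (evT (Var 0) (Var 2)) (evsT (Var 1) (Var 2))),
    (idT zT, zT),
    (idT (sT (Var 0)), sT (Var 0)),
    (doneT zT, okT),
    (doneT (sT (Var 0)), okT),
    (startT (Var 0), okT),
    (startT (Var 0), checkT (Var 0) zT),
    (checkT (insT (Var 0)) (Var 1), checkT (Var 0) (sT (Var 1)))]"

text \<open>The only rule that depends on \<open>p\<close> and \<open>n\<close>. The counter
  accumulated by \<open>checkT\<close> becomes the second argument of the program.\<close>

definition run_rule :: "recf \<Rightarrow> nat \<Rightarrow> trm \<times> trm" where
  "run_rule p n = (checkT inzT (Var 0), doneT (evT (prog p) (consT (num n) (consT (Var 0) nilT))))"

text \<open>One rule for each symbol other than the input constructors, defined symbols included,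
  since a single pattern cannot express "any other symbol". The variable \<open>Var k\<close> is
  distinct from the arguments of \<open>f\<close>.\<close>

definition junk_rules :: "(trm \<times> trm) list" where
  "junk_rules = map (\<lambda>(f, k). (checkT (Fun f (map Var [0..<k])) (Var k), okT))
     (filter (\<lambda>(f, k). f \<notin> {28, 29}) interp_sig)"

definition interp_trs :: "recf \<Rightarrow> nat \<Rightarrow> trs" where
  "interp_trs p n = (interp_sig, run_rule p n # interp_rules @ junk_rules)"

lemma vars_num [simp]: "vars (num n) = {}"
  by (induction n) auto

lemma vars_listT: "vars (listT ts) = (\<Union>t \<in> set ts. vars t)"
  by (induction ts) auto

lemma vars_prog [simp]: "vars (prog p) = {}"
  by (induction p) (auto simp: vars_listT)

lemma subst_ground: "vars t = {} \<Longrightarrow> subst \<sigma> t = t"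
  by (induction t) (auto intro: map_idI)

lemma wf_num [simp]: "wf_term interp_sig (num n)"
  by (induction n) (auto simp: interp_sig_def)

lemma wf_innum [simp]: "wf_term interp_sig (innum n)" "vars (innum n) = {}"
  by (induction n) (auto simp: interp_sig_def)

lemma wf_listT: "(\<And>t. t \<in> set ts \<Longrightarrow> wf_term interp_sig t) \<Longrightarrow> wf_term interp_sig (listT ts)"
  by (induction ts) (auto simp: interp_sig_def)

lemma wf_prog [simp]: "wf_term interp_sig (prog p)"
proof (induction p)
  case (Comp f gs)
  then have "wf_term interp_sig (listT (map prog gs))" by (intro wf_listT) auto
  with Comp show ?case by (simp add: interp_sig_def)
next
  case (Proj i)
  show ?case using wf_num[of i] by (simp add: interp_sig_def)
qed (simp_all add: interp_sig_def)

lemma wf_interp_trs: "wf_trs (interp_trs p n)"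
proof -
  have "rule \<in> set interp_rules \<or> rule \<in> set junk_rules \<or> rule = run_rule p n
    \<Longrightarrow> case rule of (l, r) \<Rightarrow> wf_term interp_sig l \<and> wf_term interp_sig r \<and>
         (\<forall>x. l \<noteq> Var x) \<and> vars r \<subseteq> vars l" for rule
  proof (elim disjE)
    assume "rule \<in> set interp_rules"
    then show ?thesis unfolding interp_rules_def by (auto simp: interp_sig_def)
  next
    assume "rule \<in> set junk_rules"
    then show ?thesis unfolding junk_rules_def by (auto simp: interp_sig_def)
  next
    assume "rule = run_rule p n"
    then show ?thesis using wf_num[of n] wf_prog[of p] unfolding run_rule_def by (auto simp: interp_sig_def)
  qed
  moreover have "distinct (map fst interp_sig)" by (simp add: interp_sig_def)
  ultimately show ?thesis unfolding wf_trs_def interp_trs_def by auto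
qed

text \<open>The rule instances written out, so that steps are analysed by rule inversion instead of
  by solving for substitutions.\<close>

inductive root_step :: "recf \<Rightarrow> nat \<Rightarrow> trm \<Rightarrow> trm \<Rightarrow> bool" for p n where
  "root_step p n (evT zeroP xs) zT"
| "root_step p n (evT succP (consT x xs)) (sT x)"
| "root_step p n (evT (projP zT) (consT x xs)) (idT x)"
| "root_step p n (evT (projP (sT i)) (consT x xs)) (evT (projP i) xs)"
| "root_step p n (evT (compP f gs) xs) (evT f (evsT gs xs))"
| "root_step p n (evT (precP f g) (consT zT xs)) (evT f xs)"
| "root_step p n (evT (precP f g) (consT (sT k) xs))
     (evT g (consT (evT (precP f g) (consT k xs)) (consT k xs)))"
| "root_step p n (evT (muP f) xs) (loopT (evT f (consT zT xs)) f zT xs)"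
| "root_step p n (loopT zT f k xs) (idT k)"
| "root_step p n (loopT (sT y) f k xs) (loopT (evT f (consT (sT k) xs)) f (sT k) xs)"
| "root_step p n (evsT nilT xs) nilT"
| "root_step p n (evsT (consT g gs) xs) (consT (evT g xs) (evsT gs xs))"
| "root_step p n (idT zT) zT"
| "root_step p n (idT (sT y)) (sT y)"
| "root_step p n (doneT zT) okT"
| "root_step p n (doneT (sT y)) okT"
| "root_step p n (startT x) okT"
| "root_step p n (startT x) (checkT x zT)"
| "root_step p n (checkT (insT x) y) (checkT x (sT y))"
| "root_step p n (checkT inzT y) (doneT (evT (prog p) (consT (num n) (consT y nilT))))"
| "f \<notin> {28, 29} \<Longrightarrow> (f, length ts) \<in> set interp_sig \<Longrightarrow> root_step p n (checkT (Fun f ts) y) okT"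

lemma root_step_rule:
  assumes "(l, r) \<in> set (snd (interp_trs p n))"
  shows "root_step p n (subst \<sigma> l) (subst \<sigma> r)"
proof -
  consider "(l, r) = run_rule p n" | "(l, r) \<in> set interp_rules" | "(l, r) \<in> set junk_rules"
    using assms by (auto simp: interp_trs_def)
  then show ?thesis
  proof cases
    case 1
    then show ?thesis unfolding run_rule_def
      by (auto simp: subst_ground intro: root_step.intros)
  next
    case 2
    have "\<forall>(l, r) \<in> set interp_rules. root_step p n (subst \<sigma> l) (subst \<sigma> r)"
      unfolding interp_rules_def by (simp add: root_step.intros)
    with 2 show ?thesis by blast
  next
    case 3
    then show ?thesis unfolding junk_rules_def by (auto intro!: root_step.intros)
  qed
qed

lemma interp_rule_step:
  assumes "i < length interp_rules" "s = subst ((!) \<rho>) (fst (interp_rules ! i))"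
    "t = subst ((!) \<rho>) (snd (interp_rules ! i))"
  shows "rstep (interp_trs p n) s t"
proof -
  have "(fst (interp_rules ! i), snd (interp_rules ! i)) \<in> set (snd (interp_trs p n))"
    using assms(1) by (simp add: interp_trs_def)
  from rstep.root[OF this, of "(!) \<rho>"] assms(2,3) show ?thesis by simp
qed

lemma rstep_root_step:
  assumes "root_step p n s t"
  shows "rstep (interp_trs p n) s t"
  using assms
proof cases
  case (1 xs)
  then show ?thesis by (intro interp_rule_step[of 0 _ "[xs]"]) (simp_all add: interp_rules_def)
next
  case (2 x xs)
  then show ?thesis by (intro interp_rule_step[of 1 _ "[x, xs]"]) (simp_all add: interp_rules_def)
next
  case (3 x xs)
  then show ?thesis by (intro interp_rule_step[of 2 _ "[x, xs]"]) (simp_all add: interp_rules_def)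
next
  case (4 i x xs)
  then show ?thesis by (intro interp_rule_step[of 3 _ "[i, x, xs]"]) (simp_all add: interp_rules_def)
next
  case (5 f gs xs)
  then show ?thesis by (intro interp_rule_step[of 4 _ "[f, gs, xs]"]) (simp_all add: interp_rules_def)
next
  case (6 f g xs)
  then show ?thesis by (intro interp_rule_step[of 5 _ "[f, g, xs]"]) (simp_all add: interp_rules_def)
next
  case (7 f g k xs)
  then show ?thesis by (intro interp_rule_step[of 6 _ "[f, g, k, xs]"]) (simp_all add: interp_rules_def)
next
  case (8 f xs)
  then show ?thesis by (intro interp_rule_step[of 7 _ "[f, xs]"]) (simp_all add: interp_rules_def)
next
  case (9 f k xs)
  then show ?thesis by (intro interp_rule_step[of 8 _ "[f, k, xs]"]) (simp_all add: interp_rules_def)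
next
  case (10 y f k xs)
  then show ?thesis by (intro interp_rule_step[of 9 _ "[y, f, k, xs]"]) (simp_all add: interp_rules_def)
next
  case (11 xs)
  then show ?thesis by (intro interp_rule_step[of 10 _ "[xs]"]) (simp_all add: interp_rules_def)
next
  case (12 g gs xs)
  then show ?thesis by (intro interp_rule_step[of 11 _ "[g, gs, xs]"]) (simp_all add: interp_rules_def)
next
  case 13
  then show ?thesis by (intro interp_rule_step[of 12 _ "[]"]) (simp_all add: interp_rules_def)
next
  case (14 y)
  then show ?thesis by (intro interp_rule_step[of 13 _ "[y]"]) (simp_all add: interp_rules_def)
next
  case 15
  then show ?thesis by (intro interp_rule_step[of 14 _ "[]"]) (simp_all add: interp_rules_def)
next
  case (16 y)
  then show ?thesis by (intro interp_rule_step[of 15 _ "[y]"]) (simp_all add: interp_rules_def)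
next
  case (17 x)
  then show ?thesis by (intro interp_rule_step[of 16 _ "[x]"]) (simp_all add: interp_rules_def)
next
  case (18 x)
  then show ?thesis by (intro interp_rule_step[of 17 _ "[x]"]) (simp_all add: interp_rules_def)
next
  case (19 x y)
  then show ?thesis by (intro interp_rule_step[of 18 _ "[x, y]"]) (simp_all add: interp_rules_def)
next
  case (20 y)
  have "(fst (run_rule p n), snd (run_rule p n)) \<in> set (snd (interp_trs p n))"
    by (simp add: interp_trs_def)
  from rstep.root[OF this, of "\<lambda>_. y"] 20 show ?thesis by (simp add: run_rule_def subst_ground)
next
  case (21 f ts y)
  have "(checkT (Fun f (map Var [0..<length ts])) (Var (length ts)), okT) \<in> set junk_rules"
    unfolding junk_rules_def using 21 by force
  then have "(checkT (Fun f (map Var [0..<length ts])) (Var (length ts)), okT)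
      \<in> set (snd (interp_trs p n))"
    by (simp add: interp_trs_def)
  \<comment> \<open>The environment \<open>ts @ [y]\<close> gives the arguments to the first
    variables and \<open>y\<close> to the variable \<open>Var (length ts)\<close>.\<close>
  moreover have "map (subst ((!) (ts @ [y])) \<circ> Var) [0..<length ts] = ts"
    by (rule nth_equalityI) (auto simp: nth_append)
  ultimately show ?thesis using rstep.root[of _ _ "interp_trs p n" "(!) (ts @ [y])"] 21 by fastforce
qed

lemma rstep_interp_cases:
  assumes "rstep (interp_trs p n) (Fun f ts) u"
  obtains (root) "root_step p n (Fun f ts) u"
  | (arg) i v where "i < length ts" "rstep (interp_trs p n) (ts ! i) v" "u = Fun f (ts[i := v])"
  using assms
proof cases
  case (root l r \<sigma>)
  then show ?thesis using root_step_rule[OF root(3)] that(1) by simp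
qed (use that in auto)

section \<open>Simulation of evaluation by rewriting\<close>

abbreviation nums :: "nat list \<Rightarrow> trm" where
  "nums xs \<equiv> listT (map num xs)"

lemma rsteps_root_step: "root_step p n s t \<Longrightarrow> rsteps (interp_trs p n) s t"
  by (intro r_into_rtranclp rstep_root_step)

lemma rsteps_id_num: "rsteps (interp_trs p n) (idT (num k)) (num k)"
  by (cases k) (auto intro: rsteps_root_step root_step.intros)

lemma rsteps_proj:
  "i < length xs \<Longrightarrow> rsteps (interp_trs p n) (evT (projP (num i)) (nums xs)) (num (xs ! i))"
proof (induction i arbitrary: xs)
  case 0
  then obtain x ys where xs: "xs = x # ys" by (cases xs) auto
  have "rsteps (interp_trs p n) (evT (projP zT) (nums xs)) (idT (num x))"
    unfolding xs by (auto intro: rsteps_root_step root_step.intros)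
  also have "rsteps (interp_trs p n) \<dots> (num x)" by (rule rsteps_id_num)
  finally show ?case by (simp add: xs)
next
  case (Suc i)
  then obtain x ys where xs: "xs = x # ys" by (cases xs) auto
  have "rsteps (interp_trs p n) (evT (projP (num (Suc i))) (nums xs)) (evT (projP (num i)) (nums ys))"
    unfolding xs by (auto intro: rsteps_root_step root_step.intros)
  also have "rsteps (interp_trs p n) \<dots> (num (ys ! i))" using Suc xs by simp
  finally show ?case by (simp add: xs)
qed

lemma rsteps_evs:
  assumes "list_all2 (\<lambda>g y. rsteps (interp_trs p n) (evT (prog g) xs) (num y)) gs ys"
  shows "rsteps (interp_trs p n) (evsT (listT (map prog gs)) xs) (nums ys)"
  using assms
proof (induction rule: list_all2_induct)
  case Nil
  then show ?case by (auto intro: rsteps_root_step root_step.intros)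
next
  case (Cons g gs y ys)
  have "rsteps (interp_trs p n) (evsT (listT (map prog (g # gs))) xs)
      (consT (evT (prog g) xs) (evsT (listT (map prog gs)) xs))"
    by (auto intro: rsteps_root_step root_step.intros)
  also have "rsteps (interp_trs p n) \<dots> (nums (y # ys))"
    using Cons by (auto intro: rsteps_args)
  finally show ?case .
qed

text \<open>Downward induction from the result \<open>m\<close> of the search: at \<open>m\<close>
  the test is zero and the loop exits; below \<open>m\<close> the test is a successor and the loop
  advances to \<open>Suc k\<close>.\<close>

lemma rsteps_loop:
  assumes "rsteps (interp_trs p n) (evT f (nums (m # xs))) zT"
    and "\<forall>j<m. \<exists>y. rsteps (interp_trs p n) (evT f (nums (j # xs))) (num (Suc y))"
    and "k \<le> m"
  shows "rsteps (interp_trs p n) (loopT (evT f (nums (k # xs))) f (num k) (nums xs)) (num m)"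
  using assms(3)
proof (induction rule: inc_induct)
  case base
  have "rsteps (interp_trs p n) (loopT (evT f (nums (m # xs))) f (num m) (nums xs))
      (loopT zT f (num m) (nums xs))"
    using assms(1) by (intro rsteps_args) auto
  also have "rsteps (interp_trs p n) \<dots> (idT (num m))"
    by (auto intro: rsteps_root_step root_step.intros)
  also have "rsteps (interp_trs p n) \<dots> (num m)" by (rule rsteps_id_num)
  finally show ?case .
next
  case (step k)
  then obtain y where "rsteps (interp_trs p n) (evT f (nums (k # xs))) (num (Suc y))"
    using assms(2) by blast
  then have "rsteps (interp_trs p n) (loopT (evT f (nums (k # xs))) f (num k) (nums xs))
      (loopT (sT (num y)) f (num k) (nums xs))"
    by (intro rsteps_args) auto
  also have "rsteps (interp_trs p n) \<dots> (loopT (evT f (nums (Suc k # xs))) f (num (Suc k)) (nums xs))"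
    by (auto intro: rsteps_root_step root_step.intros)
  also note step.IH
  finally show ?case .
qed

text \<open>Rewriting can follow the call-by-value order of \<open>eval\<close>, bringing arguments
  to numerals before the outer program continues.\<close>

lemma eval_rsteps:
  "eval q xs v \<Longrightarrow> rsteps (interp_trs p n) (evT (prog q) (nums xs)) (num v)"
proof (induction rule: eval.induct)
  case (ev_proj i xs)
  then show ?case by (simp add: rsteps_proj)
next
  case (ev_comp xs gs ys f z)
  have "rsteps (interp_trs p n) (evT (prog (Comp f gs)) (nums xs))
     (evT (prog f) (evsT (listT (map prog gs)) (nums xs)))"
    by (auto intro: rsteps_root_step root_step.intros)
  also have "rsteps (interp_trs p n) \<dots> (evT (prog f) (nums ys))"
    using ev_comp by (intro rsteps_args) (auto intro!: rsteps_evs elim: list_all2_mono)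
  also note ev_comp.IH(2)
  finally show ?case .
next
  case (ev_prec0 f xs y g)
  have "rsteps (interp_trs p n) (evT (prog (Prec f g)) (nums (0 # xs))) (evT (prog f) (nums xs))"
    by (auto intro: rsteps_root_step root_step.intros)
  also note ev_prec0.IH
  finally show ?case .
next
  case (ev_precS f g k xs y z)
  have "rsteps (interp_trs p n) (evT (prog (Prec f g)) (nums (Suc k # xs)))
     (evT (prog g) (consT (evT (prog (Prec f g)) (nums (k # xs))) (nums (k # xs))))"
    by (auto intro: rsteps_root_step root_step.intros)
  also have "rsteps (interp_trs p n) \<dots> (evT (prog g) (nums (y # k # xs)))"
    using ev_precS by (auto intro!: rsteps_args)
  also note ev_precS.IH(2)
  finally show ?case .
next
  case (ev_mu f m xs)
  have "rsteps (interp_trs p n) (evT (prog (Mu f)) (nums xs))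
     (loopT (evT (prog f) (nums (0 # xs))) (prog f) (num 0) (nums xs))"
    by (auto intro: rsteps_root_step root_step.intros)
  also have "rsteps (interp_trs p n) \<dots> (num m)"
    using ev_mu by (intro rsteps_loop) auto
  finally show ?case .
qed (auto intro: rsteps_root_step root_step.intros)

section \<open>Values and divergence\<close>

inductive_cases eval_ZeroE: "eval Zero xs v"
inductive_cases eval_SuccE: "eval Succ xs v"
inductive_cases eval_ProjE: "eval (Proj i) xs v"
inductive_cases eval_CompE: "eval (Comp f gs) xs v"
inductive_cases eval_Prec0E: "eval (Prec f g) (0 # xs) v"
inductive_cases eval_PrecSE: "eval (Prec f g) (Suc k # xs) v"
inductive_cases eval_MuE: "eval (Mu f) xs v"

text \<open>Excludes a search test with both a zero and a positive value, on which the analysis of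
  loops rests.\<close>

lemma eval_determ: "eval q xs v \<Longrightarrow> eval q xs w \<Longrightarrow> v = w"
proof (induction arbitrary: w rule: eval.induct)
  case (ev_comp xs gs ys f z)
  from ev_comp.prems obtain ys' where ys': "list_all2 (\<lambda>g y. eval g xs y) gs ys'" "eval f ys' w"
    by (elim eval_CompE)
  have "ys = ys'"
    using ev_comp.IH(1) ys'(1)
    by (induction arbitrary: ys' rule: list_all2_induct) (auto simp: list_all2_Cons1)
  with ys'(2) ev_comp.IH(2) show ?case by blast
next
  case (ev_precS f g k xs y z)
  from ev_precS.prems obtain y' where "eval (Prec f g) (k # xs) y'" "eval g (y' # k # xs) w"
    by (auto elim: eval_PrecSE)
  with ev_precS.IH show ?case by blast
next
  case (ev_mu f m xs)
  from ev_mu.prems obtain "eval f (w # xs) 0" "\<forall>j<w. \<exists>y. eval f (j # xs) (Suc y)"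
    by (auto elim: eval_MuE)
  with ev_mu.IH show ?case by (cases m w rule: linorder_cases) force+
qed (blast elim: eval_ZeroE eval_SuccE eval_ProjE eval_Prec0E)+

fun constructor_ground :: "trm \<Rightarrow> bool" where
  "constructor_ground (Var x) \<longleftrightarrow> False"
| "constructor_ground (Fun f ts) \<longleftrightarrow> f \<notin> defined_symbols \<and> (\<forall>t \<in> set ts. constructor_ground t)"

text \<open>Every rule is rooted in a defined symbol. Hence the programs and input numerals inside a
  computation never change.\<close>

lemma constructor_ground_normal: "constructor_ground t \<Longrightarrow> \<not> rstep (interp_trs p n) t u"
proof (induction t arbitrary: u)
  case (Fun f ts)
  show ?case
  proof
    assume "rstep (interp_trs p n) (Fun f ts) u"
    then show False
    proof (cases rule: rstep_interp_cases)
      case root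
      then show ?thesis using Fun.prems by (auto elim: root_step.cases)
    next
      case (arg i v)
      then show ?thesis using Fun nth_mem by fastforce
    qed
  qed
qed simp

lemma constructor_ground_num [simp]: "constructor_ground (num n)" "constructor_ground (innum n)"
  by (induction n) auto

lemma constructor_ground_listT:
  "(\<And>t. t \<in> set ts \<Longrightarrow> constructor_ground t) \<Longrightarrow> constructor_ground (listT ts)"
  by (induction ts) auto

lemma constructor_ground_prog [simp]: "constructor_ground (prog q)"
  by (induction q) (auto intro!: constructor_ground_listT)

datatype val = N nat | L "nat list"

text \<open>The number or list that a partly evaluated term stands for, provided that its
  subcomputations converge. Programs occur literally as \<open>prog q\<close>, a normal form. In
  \<open>loop\<close>, \<open>v\<close> is the value of the current test at \<open>k\<close>, and
  \<open>m\<close> is the first zero of \<open>f\<close> from \<open>k\<close> on, with positive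
  values before it.\<close>

inductive has_val :: "trm \<Rightarrow> val \<Rightarrow> bool" where
  z: "has_val zT (N 0)"
| s: "has_val t (N k) \<Longrightarrow> has_val (sT t) (N (Suc k))"
| nil: "has_val nilT (L [])"
| cons: "has_val t (N k) \<Longrightarrow> has_val ts (L ks) \<Longrightarrow> has_val (consT t ts) (L (k # ks))"
| ev: "has_val ts (L xs) \<Longrightarrow> eval q xs v \<Longrightarrow> has_val (evT (prog q) ts) (N v)"
| evs: "has_val ts (L xs) \<Longrightarrow> list_all2 (\<lambda>g y. eval g xs y) gs ys \<Longrightarrow>
    has_val (evsT (listT (map prog gs)) ts) (L ys)"
| id: "has_val t (N k) \<Longrightarrow> has_val (idT t) (N k)"
| loop: "has_val t (N v) \<Longrightarrow> has_val u (N k) \<Longrightarrow> has_val ts (L xs) \<Longrightarrow> eval f (k # xs) v \<Longrightarrow>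
    k \<le> m \<Longrightarrow> eval f (m # xs) 0 \<Longrightarrow> (\<forall>j. k \<le> j \<and> j < m \<longrightarrow> (\<exists>y. eval f (j # xs) (Suc y))) \<Longrightarrow>
    has_val (loopT t (prog f) u ts) (N m)"

inductive_cases has_val_zE: "has_val zT v"
inductive_cases has_val_sE: "has_val (sT t) v"
inductive_cases has_val_consE: "has_val (consT t ts) v"
inductive_cases root_evE: "root_step p n (evT t u) v"
inductive_cases root_evsE: "root_step p n (evsT t u) v"
inductive_cases root_idE: "root_step p n (idT t) v"
inductive_cases root_loopE: "root_step p n (loopT t u v w) x"
inductive_cases root_doneE: "root_step p n (doneT t) v"
inductive_cases root_checkE: "root_step p n (checkT t u) v"
inductive_cases root_constructorE: "root_step p n zT v" "root_step p n (sT t) v"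
  "root_step p n nilT v" "root_step p n (consT t u) v" "root_step p n okT v"

text \<open>Contracting an evaluation redex amounts to inverting the derivation of
  \<open>eval\<close>, which also supplies the convergence of the subcomputations.\<close>

lemma has_val_root_ev:
  assumes "root_step p n (evT (prog q) ts) u" "has_val ts (L xs)" "eval q xs v"
  shows "has_val u (N v)"
proof (cases q)
  case Zero
  with assms show ?thesis by (auto elim!: root_evE eval_ZeroE intro: has_val.intros)
next
  case Succ
  with assms show ?thesis
    by (auto elim!: root_evE eval_SuccE has_val_consE intro: has_val.intros)
next
  case (Proj i)
  from assms(3)[unfolded Proj] have i: "i < length xs" "v = xs ! i" by (auto elim: eval_ProjE)
  from assms(1)[unfolded Proj] obtain t ts' where ts: "ts = consT t ts'"
    and u: "(i = 0 \<and> u = idT t) \<or> (\<exists>j. i = Suc j \<and> u = evT (prog (Proj j)) ts')"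
    by (cases i) (auto elim!: root_evE)
  from assms(2)[unfolded ts] obtain k ks where xs: "xs = k # ks" "has_val t (N k)" "has_val ts' (L ks)"
    by (auto elim: has_val_consE)
  from u show ?thesis
  proof (elim disjE exE conjE)
    fix j assume "i = Suc j" "u = evT (prog (Proj j)) ts'"
    moreover have "eval (Proj j) ks (ks ! j)" using i xs \<open>i = Suc j\<close> by (intro ev_proj) simp
    ultimately show ?thesis using i xs has_val.ev[of ts' ks "Proj j" "ks ! j"] by simp
  qed (use i xs in \<open>auto intro: has_val.intros\<close>)
next
  case (Comp f gs)
  with assms show ?thesis
    by (auto elim!: root_evE eval_CompE intro!: has_val.intros)
next
  case (Prec f g)
  from assms(1)[unfolded Prec] consider
    ts' where "ts = consT zT ts'" "u = evT (prog f) ts'"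
  | t ts' where "ts = consT (sT t) ts'"
      "u = evT (prog g) (consT (evT (prog (Prec f g)) (consT t ts')) (consT t ts'))"
    by (auto elim!: root_evE)
  then show ?thesis
  proof cases
    case (1 ts')
    with assms Prec show ?thesis
      by (auto elim!: eval_Prec0E has_val_consE has_val_zE intro: has_val.intros)
  next
    case (2 t ts')
    then obtain k ks where xs: "xs = Suc k # ks" "has_val t (N k)" "has_val ts' (L ks)"
      using assms(2) by (auto elim!: has_val_consE has_val_sE)
    with assms(3) Prec obtain y where "eval (Prec f g) (k # ks) y" "eval g (y # k # ks) v"
      by (auto elim: eval_PrecSE)
    moreover from this(1) xs have "has_val (evT (prog (Prec f g)) (consT t ts')) (N y)"
      by (blast intro: has_val.ev has_val.cons)
    ultimately have "has_val (evT (prog g) (consT (evT (prog (Prec f g)) (consT t ts')) (consT t ts'))) (N v)"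
      using xs by (blast intro: has_val.ev has_val.cons)
    with 2 show ?thesis by simp
  qed
next
  case (Mu f)
  from assms(3)[unfolded Mu] have v: "eval f (v # xs) 0" "\<forall>j<v. \<exists>y. eval f (j # xs) (Suc y)"
    by (auto elim: eval_MuE)
  \<comment> \<open>The first test converges: it is the final zero if \<open>v = 0\<close>, and one
    of the positive tests before it otherwise.\<close>
  obtain w where w: "eval f (0 # xs) w" using v by (cases v) auto
  from assms(1)[unfolded Mu] have "u = loopT (evT (prog f) (consT zT ts)) (prog f) zT ts"
    by (auto elim: root_evE)
  moreover have "has_val (evT (prog f) (consT zT ts)) (N w)"
    using w assms(2) by (blast intro: has_val.ev has_val.cons has_val.z)
  ultimately show ?thesis using v w assms(2) by (auto intro!: has_val.loop has_val.z)
qed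

text \<open>The converse of preservation fails: \<open>eval\<close> is call-by-value, whereas rewriting may discard a
  diverging argument.\<close>

lemma has_val_rstep:
  assumes "has_val t v" "rstep (interp_trs p n) t u"
  shows "has_val u v"
  using assms
proof (induction arbitrary: u rule: has_val.induct)
  case z
  then show ?case by (auto elim!: rstep_interp_cases root_constructorE)
next
  case (s t k)
  from s.prems show ?case
    by (cases rule: rstep_interp_cases) (auto elim!: root_constructorE intro: s.IH has_val.intros)
next
  case nil
  then show ?case by (auto elim!: rstep_interp_cases root_constructorE)
next
  case (cons t k ts ks)
  from cons.prems show ?case
    by (cases rule: rstep_interp_cases)
      (auto elim!: root_constructorE simp: less_Suc_eq intro!: has_val.cons intro: cons.IH cons.hyps)
next
  case (ev ts xs q v)
  from ev.prems show ?case
  proof (cases rule: rstep_interp_cases)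
    case root
    then show ?thesis using ev.hyps has_val_root_ev by blast
  next
    case (arg i w)
    then show ?thesis using constructor_ground_normal[of "prog q"]
      by (auto simp: less_Suc_eq intro: has_val.ev[OF ev.IH ev.hyps(2)])
  qed
next
  case (evs ts xs gs ys)
  from evs.prems show ?case
  proof (cases rule: rstep_interp_cases)
    case root
    then show ?thesis using evs.hyps
      by (cases gs) (auto elim!: root_evsE simp: list_all2_Cons1 intro!: has_val.intros)
  next
    case (arg i w)
    have "constructor_ground (listT (map prog gs))" by (intro constructor_ground_listT) auto
    with arg show ?thesis using constructor_ground_normal[of "listT (map prog gs)"]
      by (auto simp: less_Suc_eq intro: has_val.evs[OF evs.IH evs.hyps(2)])
  qed
next
  case (id t k)
  from id.prems show ?case
    by (cases rule: rstep_interp_cases)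
      (use id.hyps in \<open>auto elim!: root_idE intro: has_val.id[OF id.IH]\<close>)
next
  case (loop t v w k ts xs f m)
  from loop.prems show ?case
  proof (cases rule: rstep_interp_cases)
    case root
    then consider "t = zT" "u = idT w"
    | y where "t = sT y" "u = loopT (evT (prog f) (consT (sT w) ts)) (prog f) (sT w) ts"
      by (auto elim!: root_loopE)
    then show ?thesis
    proof cases
      case 1
      then have "v = 0" using loop.hyps(1) by (auto elim: has_val_zE)
      \<comment> \<open>A zero test means that the search is over: for \<open>k < m\<close> the test
        at \<open>k\<close> would be positive, against determinism.\<close>
      have "m = k"
      proof (rule ccontr)
        assume "m \<noteq> k"
        then obtain y where "eval f (k # xs) (Suc y)" using loop.hyps by force
        with loop.hyps(4) \<open>v = 0\<close> eval_determ show False by blast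
      qed
      then show ?thesis using 1 loop.hyps by (auto intro: has_val.intros)
    next
      case (2 y)
      then obtain v' where v: "v = Suc v'" using loop.hyps(1) by (auto elim: has_val_sE)
      then have "k \<noteq> m" using loop.hyps(4,6) eval_determ by blast
      then have km: "Suc k \<le> m" using loop.hyps by simp
      \<comment> \<open>The advanced loop needs a value for its next test: zero if
        \<open>Suc k = m\<close>, positive below \<open>m\<close>.\<close>
      have "\<exists>v''. eval f (Suc k # xs) v''"
      proof (cases "Suc k = m")
        case False
        then have "k \<le> Suc k \<and> Suc k < m" using km by simp
        then show ?thesis using loop.hyps(7) by blast
      qed (use loop.hyps(6) in blast)
      then obtain v'' where v'': "eval f (Suc k # xs) v''" by blast
      have "has_val (evT (prog f) (consT (sT w) ts)) (N v'')"
        using loop.hyps v'' by (blast intro: has_val.ev has_val.cons has_val.s)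
      then show ?thesis using 2 loop.hyps v'' km
        by (auto intro!: has_val.loop[of _ v'' _ "Suc k"] has_val.s)
    qed
  next
    case (arg i x)
    then show ?thesis using constructor_ground_normal[of "prog f"]
      by (auto simp: less_Suc_eq
          intro: has_val.loop[OF loop.IH(1) loop.hyps(2-)] has_val.loop[OF loop.hyps(1) loop.IH(2) loop.hyps(3-)]
            has_val.loop[OF loop.hyps(1,2) loop.IH(3) loop.hyps(4-)])
  qed
qed

text \<open>The stages of a check meant to diverge: counting, with \<open>j\<close> layers of input
  left and \<open>k\<close> counted; the start of the search; its loop at position \<open>k\<close>.
  Components are described by their values, so they may be partly evaluated, and \<open>okT\<close>
  is none of the stages.\<close>

inductive diverging :: "recf \<Rightarrow> nat \<Rightarrow> nat \<Rightarrow> trm \<Rightarrow> bool" for f n x where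
  check: "has_val t (N k) \<Longrightarrow> j + k = x \<Longrightarrow> diverging f n x (checkT (innum j) t)"
| start: "has_val t (L [n, x]) \<Longrightarrow> diverging f n x (doneT (evT (muP (prog f)) t))"
| loop: "has_val t (N v) \<Longrightarrow> has_val u (N k) \<Longrightarrow> has_val ts (L [n, x]) \<Longrightarrow> eval f [k, n, x] v \<Longrightarrow>
    diverging f n x (doneT (loopT t (prog f) u ts))"

lemma has_val_num: "has_val (num n) (N n)"
  by (induction n) (auto intro: has_val.intros)

text \<open>\<open>doneT\<close> fires only on numerals, while its argument stays headed by
  \<open>evT\<close> or \<open>loopT\<close>. The loop can be left only when its test is
  \<open>zT\<close>, whose value 0 contradicts the positive value of \<open>f\<close>.\<close>

lemma diverging_rstep:
  assumes div: "\<And>k. \<exists>y. eval f [k, n, x] (Suc y)"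
    and "diverging f n x t" "rstep (interp_trs (Mu f) n) t u"
  shows "diverging f n x u"
  using assms(2)
proof cases
  case (check s k j)
  from assms(3)[unfolded check] show ?thesis
  proof (cases rule: rstep_interp_cases)
    case root
    show ?thesis
    proof (cases j)
      case 0
      with root have "u = doneT (evT (muP (prog f)) (consT (num n) (consT s nilT)))"
        by (auto elim: root_checkE)
      moreover have "has_val (consT (num n) (consT s nilT)) (L [n, x])"
        using check 0 by (auto intro!: has_val.cons has_val.nil has_val_num)
      ultimately show ?thesis by (auto intro: diverging.start)
    next
      case (Suc i)
      with root have "u = checkT (innum i) (sT s)" by (auto elim: root_checkE)
      then show ?thesis using check Suc by (auto intro: diverging.check has_val.s)
    qed
  next
    case (arg i v)
    then show ?thesis using constructor_ground_normal[of "innum j"]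
      by (auto simp: less_Suc_eq intro: diverging.check[OF has_val_rstep[OF check(2)] check(3)])
  qed
next
  case (start s)
  from assms(3)[unfolded start] show ?thesis
  proof (cases rule: rstep_interp_cases)
    case root
    then show ?thesis by (auto elim: root_doneE)
  next
    case (arg i v)
    then have step: "rstep (interp_trs (Mu f) n) (evT (muP (prog f)) s) v" and u: "u = doneT v"
      by auto
    from step show ?thesis
    proof (cases rule: rstep_interp_cases)
      case root
      then have v: "v = loopT (evT (prog f) (consT zT s)) (prog f) zT s" by (auto elim: root_evE)
      obtain y where y: "eval f [0, n, x] (Suc y)" using div by blast
      then have "has_val (evT (prog f) (consT zT s)) (N (Suc y))"
        using start(2) by (blast intro: has_val.ev has_val.cons has_val.z)
      then show ?thesis using y start(2) unfolding u v by (blast intro: diverging.loop has_val.z)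
    next
      case (arg i w)
      have "constructor_ground (muP (prog f))" by simp
      with arg show ?thesis
        using u constructor_ground_normal[of "muP (prog f)"]
        by (auto simp: less_Suc_eq intro: diverging.start[OF has_val_rstep[OF start(2)]])
    qed
  qed
next
  case (loop t' v w k ts)
  obtain y where "eval f [k, n, x] (Suc y)" using div by blast
  then have v: "v = Suc y" using loop(5) eval_determ by blast
  from assms(3)[unfolded loop] show ?thesis
  proof (cases rule: rstep_interp_cases)
    case root
    then show ?thesis by (auto elim: root_doneE)
  next
    case (arg i s)
    then have step: "rstep (interp_trs (Mu f) n) (loopT t' (prog f) w ts) s" and u: "u = doneT s"
      by auto
    from step show ?thesis
    proof (cases rule: rstep_interp_cases)
      case root
      have "t' \<noteq> zT" using loop(2) v by (auto elim: has_val_zE)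
      with root have s: "s = loopT (evT (prog f) (consT (sT w) ts)) (prog f) (sT w) ts"
        by (auto elim: root_loopE)
      obtain z where z: "eval f [Suc k, n, x] (Suc z)" using div by blast
      then have "has_val (evT (prog f) (consT (sT w) ts)) (N (Suc z))"
        using loop(3,4) by (blast intro: has_val.ev has_val.cons has_val.s)
      then show ?thesis using z loop(3,4) unfolding u s by (blast intro: diverging.loop has_val.s)
    next
      case (arg i r)
      then show ?thesis
        using u constructor_ground_normal[of "prog f"]
        by (auto simp: less_Suc_eq intro: diverging.loop[OF has_val_rstep[OF loop(2)] loop(3-5)]
            diverging.loop[OF loop(2) has_val_rstep[OF loop(3)] loop(4,5)]
            diverging.loop[OF loop(2,3) has_val_rstep[OF loop(4)] loop(5)])
    qed
  qed
qed

text \<open>\<open>okT\<close> is a normal form, so the peak at \<open>startT\<close> could be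
  joined only in \<open>okT\<close>, whereas all reducts of the other side stay
  \<open>diverging\<close>.\<close>

lemma not_weakly_ground_confluent:
  assumes "\<And>k. \<exists>y. eval f [k, n, x] (Suc y)"
  shows "\<not> weakly_ground_confluent (interp_trs (Mu f) n)"
proof
  let ?R = "interp_trs (Mu f) n"
  assume "weakly_ground_confluent ?R"
  moreover have "ground (startT (innum x))" "wf_term (fst ?R) (startT (innum x))"
    using wf_innum[of x] by (auto simp: ground_def interp_trs_def interp_sig_def)
  moreover have "rstep ?R (startT (innum x)) okT" "rstep ?R (startT (innum x)) (checkT (innum x) zT)"
    by (auto intro: rstep_root_step root_step.intros)
  ultimately obtain d where d: "rsteps ?R okT d" "rsteps ?R (checkT (innum x) zT) d"
    unfolding weakly_ground_confluent_def weakly_confluent_on_def by blast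
  have "d = okT"
    using d(1) by (induction) (use constructor_ground_normal[of okT] in auto)
  have "diverging f n x d"
    using d(2)
  proof induction
    case base
    show ?case by (rule diverging.check[OF has_val.z]) simp
  qed (rule diverging_rstep[OF assms])
  with \<open>d = okT\<close> show False by (auto elim: diverging.cases)
qed

section \<open>Weak ground confluence of the interpreter\<close>

lemma interp_lhs:
  "\<forall>(l, r) \<in> set (snd (interp_trs p n)). \<exists>f ls. l = Fun f ls \<and> f \<notin> - defined_symbols"
proof -
  have "\<forall>(l, r) \<in> set interp_rules. \<exists>f ls. l = Fun f ls \<and> f \<notin> - defined_symbols"
    unfolding interp_rules_def by simp
  then show ?thesis by (auto simp: interp_trs_def run_rule_def junk_rules_def)
qed

text \<open>The junk rules are left out: the symbol below \<open>checkT\<close> may be a defined one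
  there, so they overlap with other rules and get a separate treatment.\<close>

lemma interp_rules_linear:
  assumes "(l, r) \<in> set (run_rule p n # interp_rules)"
  shows "\<exists>f ls. l = Fun f ls \<and> disjoint_vars ls \<and>
     (\<forall>t \<in> set ls. linear_over (- defined_symbols) t)"
proof -
  have "\<forall>(l, r) \<in> set interp_rules. \<exists>f ls. l = Fun f ls \<and> disjoint_vars ls \<and>
     (\<forall>t \<in> set ls. linear_over (- defined_symbols) t)"
    unfolding interp_rules_def by simp
  with assms show ?thesis by (auto simp: run_rule_def)
qed

lemma root_step_cases:
  assumes "rstep (interp_trs p n) (Fun f ts) u"
  obtains (rule) ls r \<sigma> where "(Fun f ls, r) \<in> set (run_rule p n # interp_rules)"
      "ts = map (subst \<sigma>) ls" "u = subst \<sigma> r" "root_step p n (Fun f ts) u"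
  | (junk) g ss y where "f = 27" "ts = [Fun g ss, y]" "g \<notin> {28, 29}" "(g, length ss) \<in> set interp_sig"
      "u = okT" "root_step p n (Fun f ts) u"
  | (arg) i v where "i < length ts" "rstep (interp_trs p n) (ts ! i) v" "u = Fun f (ts[i := v])"
  using assms
proof cases
  case (root l r \<sigma>)
  note rs = root_step_rule[OF root(3), of \<sigma>]
  consider "(l, r) \<in> set (run_rule p n # interp_rules)" | "(l, r) \<in> set junk_rules"
    using root(3) by (auto simp: interp_trs_def)
  then show ?thesis
  proof cases
    case 1
    then obtain g ls where "l = Fun g ls" using interp_rules_linear by blast
    with 1 root rs show ?thesis by (intro rule[of ls r \<sigma>]) auto
  next
    case 2
    with root rs show ?thesis by (auto simp: junk_rules_def intro!: junk)
  qed
qed (use arg in auto)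

text \<open>Left-hand sides exclude each other at the root, except for the two rules for
  \<open>startT\<close>.\<close>

lemma root_step_determ:
  assumes "root_step p n s t" "root_step p n s u" "\<And>x. s \<noteq> startT x"
  shows "t = u"
  using assms(1)
  by cases (use assms(2,3) in \<open>auto elim!: root_evE root_evsE root_idE root_loopE root_doneE root_checkE\<close>)

lemma root_step_result:
  assumes "root_step p n s t"
  shows "\<exists>f ts. t = Fun f ts \<and> f \<notin> {28, 29}"
  using assms by cases auto

definition joinable :: "trs \<Rightarrow> trm \<Rightarrow> trm \<Rightarrow> bool" where
  "joinable R s t \<longleftrightarrow> (\<exists>d. rsteps R s d \<and> rsteps R t d)"

lemma joinable_sym: "joinable R s t \<Longrightarrow> joinable R t s"
  unfolding joinable_def by blast

lemma joinable_refl: "joinable R s s"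
  unfolding joinable_def by blast

lemma junk_to_ok:
  assumes "wf_term interp_sig (Fun g ss)" "g \<notin> {28, 29}"
  shows "rsteps (interp_trs p n) (checkT (Fun g ss) y) okT"
  using assms by (auto intro!: rsteps_root_step root_step.intros)

text \<open>An inner step keeps the head symbol and a root step never yields an input constructor,
  so junk remains junk.\<close>

lemma rstep_junk:
  assumes "rstep (interp_trs p n) (Fun g ss) u" "g \<notin> {28, 29}"
  shows "\<exists>h us. u = Fun h us \<and> h \<notin> {28, 29}"
  using assms(1)
proof (cases rule: rstep_interp_cases)
  case root
  then show ?thesis by (rule root_step_result)
qed (use assms(2) in auto)

text \<open>The checked term is left unreduced: its layers of \<open>insT\<close> are counted off,
  and the first other symbol is either \<open>inzT\<close>, where the program is run on the count
  and halts by assumption, or junk. The counter stays a numeral, as \<open>eval_rsteps\<close>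
  requires.\<close>

lemma check_to_ok:
  assumes halt: "\<And>k. \<exists>v. eval p [n, k] v" and "ground s" "wf_term interp_sig s"
  shows "rsteps (interp_trs p n) (checkT s (num k)) okT"
  using assms(2,3)
proof (induction s arbitrary: k)
  case (Var x)
  then show ?case by (simp add: ground_def)
next
  case (Fun g ss)
  consider "g = 28" | "g = 29" | "g \<notin> {28, 29}" by blast
  then show ?case
  proof cases
    case 1
    then have "ss = []" using Fun.prems by (auto simp: interp_sig_def)
    have "rsteps (interp_trs p n) (checkT inzT (num k)) (doneT (evT (prog p) (nums [n, k])))"
      by (auto intro!: rsteps_root_step root_step.intros)
    also obtain v where "eval p [n, k] v" using halt by blast
    from eval_rsteps[OF this]
    have "rsteps (interp_trs p n) (doneT (evT (prog p) (nums [n, k]))) (doneT (num v))"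
      by (intro rsteps_args) simp
    also have "rsteps (interp_trs p n) \<dots> okT"
      by (cases v) (auto intro!: rsteps_root_step root_step.intros)
    finally show ?thesis using 1 \<open>ss = []\<close> by simp
  next
    case 2
    then obtain s where s: "ss = [s]"
      using Fun.prems by (auto simp: interp_sig_def length_Suc_conv)
    have "rsteps (interp_trs p n) (checkT (insT s) (num k)) (checkT s (num (Suc k)))"
      by (auto intro!: rsteps_root_step root_step.intros)
    also have "rsteps (interp_trs p n) \<dots> okT"
      using Fun.prems s by (intro Fun.IH) (auto simp: ground_def)
    finally show ?thesis using 2 s by simp
  next
    case 3
    then show ?thesis using Fun.prems(2) by (intro junk_to_ok)
  qed
qed

lemma rule_arg_joinable:
  assumes "(Fun f ls, r) \<in> set (run_rule p n # interp_rules)"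
    and "i < length ls" "rstep (interp_trs p n) (subst \<sigma> (ls ! i)) u"
  shows "joinable (interp_trs p n) (subst \<sigma> r) (Fun f ((map (subst \<sigma>) ls)[i := u]))"
  unfolding joinable_def
  by (rule root_inner_join[OF interp_lhs _ _ _ assms(2,3)])
    (use assms(1) interp_rules_linear[OF assms(1)] in \<open>auto simp: interp_trs_def\<close>)

text \<open>A step at position 0 leaves a well-formed junk term, and one at position 1 changes only
  the counter; either way a junk rule still applies.\<close>

lemma junk_arg_joinable:
  assumes "g \<notin> {28, 29}" "wf_term interp_sig (Fun g ss)"
    and "i < 2" "rstep (interp_trs p n) ([Fun g ss, y] ! i) u"
  shows "joinable (interp_trs p n) okT (Fun 27 ([Fun g ss, y][i := u]))"
proof -
  have "rsteps (interp_trs p n) (Fun 27 ([Fun g ss, y][i := u])) okT"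
  proof (cases "i = 0")
    case True
    with assms obtain h us where u: "u = Fun h us" "h \<notin> {28, 29}" using rstep_junk by fastforce
    have "wf_term interp_sig u"
      using rstep_wf_term[OF _ wf_interp_trs, of p n "Fun g ss" u] assms True
      by (simp add: interp_trs_def)
    then show ?thesis using junk_to_ok u True by simp
  next
    case False
    then have "i = 1" using assms(3) by simp
    then show ?thesis using junk_to_ok[OF assms(2,1)] by simp
  qed
  then show ?thesis unfolding joinable_def by blast
qed

lemma args_joinable:
  assumes "i < length ts" "rstep R (ts ! i) v" "j < length ts" "rstep R (ts ! j) w"
    and "i = j \<Longrightarrow> joinable R v w"
  shows "joinable R (Fun f (ts[i := v])) (Fun f (ts[j := w]))"
proof (cases "i = j")
  case True
  then obtain d where "rsteps R v d" "rsteps R w d" using assms(5) unfolding joinable_def by blast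
  then show ?thesis
    using True assms(1) rsteps_ctxt[of R _ d f "take i ts" "drop (Suc i) ts"]
    unfolding joinable_def by (metis upd_conv_take_nth_drop)
next
  case False
  have "rstep R (Fun f (ts[i := v])) (Fun f (ts[i := v, j := w]))"
    "rstep R (Fun f (ts[j := w])) (Fun f (ts[j := w, i := v]))"
    using assms False by (auto intro!: rstep.ctxt)
  moreover have "ts[i := v, j := w] = ts[j := w, i := v]" using False by (rule list_update_swap)
  ultimately show ?thesis unfolding joinable_def by (metis r_into_rtranclp)
qed

text \<open>The case analysis of the critical pair lemma, on the ground well-formed terms of which
  \<open>check_to_ok\<close> speaks. Two root steps differ only at \<open>startT\<close>; a root
  step against an argument step is a variable overlap or a junk overlap; two argument steps are
  independent or fall under the induction hypothesis.\<close>

lemma interp_peak_joinable: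
  assumes halt: "\<And>k. \<exists>v. eval p [n, k] v"
    and "ground t" "wf_term interp_sig t" "rstep (interp_trs p n) t u" "rstep (interp_trs p n) t v"
  shows "joinable (interp_trs p n) u v"
  using assms(2-)
proof (induction t arbitrary: u v)
  case (Var x)
  then show ?case by (simp add: ground_def)
next
  case (Fun f ts)
  let ?R = "interp_trs p n"
  have root_root: "joinable ?R u v"
    if root: "root_step p n (Fun f ts) u" "root_step p n (Fun f ts) v" for u v
  proof (cases "\<exists>x. Fun f ts = startT x")
    case False
    then show ?thesis using root_step_determ[OF root] joinable_refl by auto
  next
    case True
    then obtain x where x: "f = 24" "ts = [x]" by auto
    \<comment> \<open>The initial counter \<open>zT\<close> is \<open>num 0\<close>, so both
      contracta of \<open>startT\<close> reach \<open>okT\<close>.\<close>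
    then have "rsteps ?R (checkT x zT) okT"
      using check_to_ok[OF halt, of x 0] Fun.prems(1,2) by (simp add: ground_def)
    moreover have "u \<in> {okT, checkT x zT}" "v \<in> {okT, checkT x zT}"
      using root x by (auto elim: root_step.cases)
    ultimately show ?thesis unfolding joinable_def by auto
  qed
  have rule_arg: "joinable ?R (subst \<sigma> r) (Fun f (ts[i := w]))"
    if "(Fun f ls, r) \<in> set (run_rule p n # interp_rules)" "ts = map (subst \<sigma>) ls"
      "i < length ts" "rstep ?R (ts ! i) w" for ls r \<sigma> i w
    using rule_arg_joinable[OF that(1), of i \<sigma> w] that by auto
  have junk_arg: "joinable ?R okT (Fun f (ts[i := w]))"
    if "f = 27" "ts = [Fun g ss, y]" "g \<notin> {28, 29}" "i < length ts" "rstep ?R (ts ! i) w"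
    for g ss y i w
    using junk_arg_joinable[of g ss i p n y w] that Fun.prems(2) by auto
  from Fun.prems(3) show ?case
  proof (cases rule: root_step_cases)
    case rule1: (rule ls r \<sigma>)
    from Fun.prems(4) show ?thesis
    proof (cases rule: root_step_cases)
      case (arg i w)
      then show ?thesis using rule_arg[OF rule1(1,2)] rule1(3) by simp
    qed (use root_root rule1(4) in blast)+
  next
    case junk1: (junk g ss y)
    from Fun.prems(4) show ?thesis
    proof (cases rule: root_step_cases)
      case (arg i w)
      then show ?thesis using junk_arg[OF junk1(1,2,3)] junk1(5) by simp
    qed (use root_root junk1(6) in blast)+
  next
    case arg1: (arg i w)
    from Fun.prems(4) show ?thesis
    proof (cases rule: root_step_cases)
      case (rule ls r \<sigma>)
      then show ?thesis using rule_arg[OF rule(1,2) arg1(1,2)] arg1(3) joinable_sym by simp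
    next
      case (junk g ss y)
      then show ?thesis using junk_arg[OF junk(1,2,3) arg1(1,2)] arg1(3) joinable_sym by simp
    next
      case (arg j w')
      have "joinable ?R w w'" if "i = j"
      proof (rule Fun.IH)
        show "ts ! i \<in> set ts" using arg1(1) by simp
        then show "ground (ts ! i)" "wf_term interp_sig (ts ! i)"
          using Fun.prems(1,2) by (auto simp: ground_def)
        show "rstep ?R (ts ! i) w" "rstep ?R (ts ! i) w'" using arg1 arg that by auto
      qed
      then show ?thesis using args_joinable[OF arg1(1,2) arg(1,2)] arg1(3) arg(3) by simp
    qed
  qed
qed

lemma weakly_ground_confluent_interp_trs:
  assumes "\<And>k. \<exists>v. eval p [n, k] v"
  shows "weakly_ground_confluent (interp_trs p n)"
  using interp_peak_joinable[OF assms]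
  unfolding weakly_ground_confluent_def weakly_confluent_on_def joinable_def interp_trs_def fst_conv
  by blast

section \<open>The reduction\<close>

lemma total_computable_encode_num: "total_computable (\<lambda>n. encode_term (num n))"
proof -
  have "encode_term (num n) = rec_nat (encode_term zT) (\<lambda>_ c. fun_code 11 (cons_code c 0)) n" for n
    by (induction n) simp_all
  then show ?thesis
    by (simp only:) (intro total_computable_rec total_computable_pair total_computable_Suc
        total_computable_const total_computable_psnd total_computable_id)
qed

text \<open>For fixed \<open>p\<close>, the code of the system is constant apart from the numeral
  \<open>num n\<close> in its first rule.\<close>

lemma total_computable_encode_interp_trs: "total_computable (\<lambda>n. encode_trs (interp_trs p n))"
  unfolding interp_trs_def run_rule_def encode_trs_def fst_conv snd_conv list.map prod.case
    list_encode.simps encode_term.simps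
  by (intro total_computable_pair total_computable_Suc total_computable_const
      total_computable_encode_num)

lemma Pi02_reducible_to_WGCR:
  assumes "A \<in> Pi02"
  shows "many_one_reducible A WGCR_codes"
proof -
  obtain Q q where Q: "A = {n. \<forall>x. \<exists>y. Q n x y}"
    and q: "\<And>n x y. eval q [n, x, y] (if Q n x y then 1 else 0)"
    using assms unfolding Pi02_def decidable3_def by blast
  obtain d where d: "\<And>x y. eval d [x, y] (x - y)"
    using computable2_diff unfolding computable2_def by blast
  \<comment> \<open>\<open>f\<close> is 0 exactly where \<open>Q\<close> holds, and \<open>y\<close>
    is moved to the front, the position in which \<open>Mu\<close> searches.\<close>
  define f where "f = Comp d [Comp Succ [Zero], Comp q [Proj 1, Proj 2, Proj 0]]"
  have f: "eval f [y, n, x] (if Q n x y then 0 else Suc 0)" for y n x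
  proof -
    have "eval (Comp q [Proj 1, Proj 2, Proj 0]) [y, n, x] (if Q n x y then 1 else 0)"
      by (rule ev_comp[OF _ q]) (auto intro: eval_Proj)
    from eval_Comp2[OF eval_Comp1[OF ev_zero ev_succ] this d] show ?thesis
      unfolding f_def by (auto split: if_splits)
  qed
  have "n \<in> A \<longleftrightarrow> encode_trs (interp_trs (Mu f) n) \<in> WGCR_codes" for n
  proof -
    have "weakly_ground_confluent (interp_trs (Mu f) n)" if "\<forall>x. \<exists>y. Q n x y"
    proof (rule weakly_ground_confluent_interp_trs)
      fix x
      \<comment> \<open>\<open>Mu f\<close> halts with the least witness, because \<open>f\<close>
        has the value 1 below it.\<close>
      let ?y = "LEAST y. Q n x y"
      have "Q n x ?y" using that by (meson LeastI_ex)
      then have "eval f (?y # [n, x]) 0" using f[of ?y n x] by simp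
      moreover have "\<exists>z. eval f (m # [n, x]) (Suc z)" if "m < ?y" for m
        using f[of m n x] not_less_Least[OF that] by auto
      ultimately show "\<exists>v. eval (Mu f) [n, x] v" by (blast intro: ev_mu)
    qed
    \<comment> \<open>Without a witness every test is 1, so the search for this \<open>x\<close>
      diverges.\<close>
    moreover have "\<not> weakly_ground_confluent (interp_trs (Mu f) n)" if "\<forall>y. \<not> Q n x y" for x
      using f[of _ n x] that by (intro not_weakly_ground_confluent[of f n x]) auto
    ultimately show ?thesis
      by (auto simp: Q WGCR_codes_iff wf_interp_trs)
  qed
  then show ?thesis
    unfolding many_one_reducible_def using total_computable_encode_interp_trs by blast
qed

theorem theorem6:
  shows "Pi02_complete WGCR_codes"
  unfolding Pi02_complete_def using WGCR_codes_in_Pi02 Pi02_reducible_to_WGCR by blast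

end
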